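(* For $k\ge3$ define $$\tau_k=\begin{cases}7\cdot 2^{2K-3}-\tfrac23\left(4^{K-2}-1\right),& k=2K-1,\\[4pt] 7\cdot 2^{2K-2}-\tfrac13\left(4^{K-1}-1\right),& k=2K.\end{cases}$$ Then for every $k\ge3$ and every $m$ with $0\le m<\tau_k$, $F_k(m)=0$.
   Context: Let $E(q)=\prod_{m\ge1}(1-q^m)$. $PDO(n)$ is the number of partitions of $n$ into odd parts with designated summands (for each distinct part size, exactly one occurrence is designated); $\sum_{n\ge0}PDO(n)q^n=\frac{E(q^4)E(q^6)^2}{E(q)E(q^3)E(q^{12})}$. Define $$\gamma(q)=\frac{E(q)^5E(q^2)^5E(q^6)^5}{E(q^3)^{15}},\quad \xi=\xi(q)=\frac{E(q^2)^5E(q^6)}{E(q)E(q^3)^5},$$ and for $k\ge3$, $\Phi_k=\gamma(q)^{2^k}\left(\sum_{n\ge0}PDO(2^{k+2}n)q^n-\sum_{n\ge0}PDO(2^kn)q^n\right)$. It is known that $\Phi_k$ equals (as a formal power series in $q$) a polynomial in $\xi$ with integer coefficients; $F_k(m)$ denote these coefficients, $\Phi_k=\sum_m F_k(m)\xi^m$. *)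

theory Defs
  imports "HOL-Computational_Algebra.Computational_Algebra" "HOL-Library.Multiset"
begin

text \<open>PDO(n): partitions of n into odd parts with designated summands. A partition into
odd parts is a multiset of odd positive naturals summing to n; for each distinct part size
exactly one of its occurrences is designated, giving (multiplicity) choices per part size.\<close>
definition PDO :: "nat \<Rightarrow> nat" where
  "PDO n = (\<Sum>M\<in>{M. (\<forall>x\<in>#M. odd x) \<and> sum_mset M = n}. \<Prod>x\<in>set_mset M. count M x)"

text \<open>E(q^a) = prod_{m>=1} (1 - q^(a m)) as a formal power series (for a >= 1);
the n-th coefficient of the infinite product equals that of the finite product over m <= n.\<close>
definition Eq :: "nat \<Rightarrow> rat fps" where
  "Eq a = Abs_fps (\<lambda>n. fps_nth (\<Prod>m\<in>{1..n}. 1 - fps_X ^ (a * m)) n)"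

definition gamma_fps :: "rat fps" where
  "gamma_fps = Eq 1 ^ 5 * Eq 2 ^ 5 * Eq 6 ^ 5 * inverse (Eq 3 ^ 15)"

definition xi_fps :: "rat fps" where
  "xi_fps = Eq 2 ^ 5 * Eq 6 * inverse (Eq 1 * Eq 3 ^ 5)"

definition Phi :: "nat \<Rightarrow> rat fps" where
  "Phi k = gamma_fps ^ (2 ^ k) *
     (Abs_fps (\<lambda>n. of_nat (PDO (2 ^ (k + 2) * n))) - Abs_fps (\<lambda>n. of_nat (PDO (2 ^ k * n))))"

definition F :: "nat \<Rightarrow> nat \<Rightarrow> int" where
  "F k m = coeff (THE p :: int poly. Phi k = poly (map_poly of_int p) xi_fps) m"

definition tau :: "nat \<Rightarrow> rat" where
  "tau k = (if odd k then
              (let K = (k + 1) div 2 in 7 * 2 ^ (2 * K - 3) - 2 / 3 * (4 ^ (K - 2) - 1))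
            else
              (let K = k div 2 in 7 * 2 ^ (2 * K - 2) - 1 / 3 * (4 ^ (K - 1) - 1)))"

end

theory Submission
  imports Defs "HOL-Library.Disjoint_Sets"
begin

text \<open>
Write $E_n = E(q^n)$ and $h = q E_2^2 E_{12}^4 / (E_4^4 E_6^2)$, an odd function of $q$. Everything rests on
the 2-dissection $E_3^3/E_1 = E_4^3 E_6^2/(E_2^2 E_{12}) (1 + h)$. Both $E_3^3/E_1$ and the eta quotient in
its even part are Lambert series, with coefficients $\sum_{d \mid 3n+1} \chi(d)$ and
$\sum_{d \mid 6n+1} \chi(d)$ for the character $\chi$ modulo 3, so the dissection is elementary arithmetic of
divisor sums. All level 12 identities then follow algebraically; in particular
$\xi(q) = (1+3h)/(1+h)^2$, $\xi(q^2) = 1/(1-h^2)$, $\gamma(q^2)^2 (1-h)^5 = \gamma(q)$ and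
$\gamma^6 = \xi^{10} (9 - 8\xi)^5$.

Let $P_k = \sum_n PDO(2^k n) q^n$. One finds $P_1 = P_0^2$ and $\gamma P_2 = 3\xi^2 - 2\xi^3$. Since
$P_{k+1}(q^2)$ is the even part of $P_k$, with $s = \xi(q^2)$ the passage from $\gamma^W P_k$ to
$\gamma^{2W} P_{k+1}$ sends $\xi^i$ to the even part of $s^{6W} (1-h)^W (1+h)^{6W-2i} (1+3h)^i$, a polynomial
in $h$ of degree at most $7W - i$ whose even powers are rewritten by $s h^2 = s - 1$. Hence the exponents
$i$ with $5W \le 3i$ and $i \le 3W$ are mapped to exponents in the same range for $2W$, and
$\gamma^{2^k} P_{k+2}$ only involves $\xi^i$ with $3i \ge 5 \cdot 2^k$. The same bound for
$\gamma^{2^k} P_k$ comes from the formula for $\gamma^6$, and $\tau_k$ is $5 \cdot 2^k / 3$ rounded up.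
\<close>

section \<open>Truncated congruences and infinite products\<close>

text \<open>Products of the E_n simplify mechanically, sums do not. Additive relations between eta
  quotients therefore enter only through the dissection and are spread by q -> -q and q -> q^2. The
  rest are monomial identities in nonzero elements E_n of the field of Laurent series, pulled back
  to power series. Several facts are proved at q^2, where h(q)^2 is available, and descend because X
  -> X^2 is injective. Negative indices in the bilateral Lambert sum would bring negative powers of
  q, so it is reached as a coefficientwise limit of finite partial fractions with natural exponents.
  Origin of 5/3: a step from weight W to 2W sends exponent i to exponents at least (5W + i)/2. The
  ratio x = i/W thus becomes at least (5 + x)/4, whose fixed point is 5/3, and gamma^6 starts at
  xi^10, the same ratio per factor gamma. The upper bound 3W is needed to clear the denominators (1
  + h)^(2i) coming from xi^i. Since \<open>F\<close> is a definite description, one must also know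
  that xi satisfies no nontrivial polynomial equation over the integers.\<close>

definition fps_agree :: "nat \<Rightarrow> 'a::zero fps \<Rightarrow> 'a fps \<Rightarrow> bool" where
  "fps_agree N f g \<longleftrightarrow> (\<forall>i<N. fps_nth f i = fps_nth g i)"

lemma fps_agree_refl [simp]: "fps_agree N f f"
  by (simp add: fps_agree_def)

lemma fps_agree_sym: "fps_agree N f g \<Longrightarrow> fps_agree N g f"
  by (simp add: fps_agree_def)

lemma fps_agree_trans [trans]: "fps_agree N f g \<Longrightarrow> fps_agree N g h \<Longrightarrow> fps_agree N f h"
  by (simp add: fps_agree_def)

lemma fps_agree_eqI: "(\<And>N. fps_agree N f g) \<Longrightarrow> f = g"
  by (auto simp: fps_agree_def fps_eq_iff)

lemma fps_agree_add:
  fixes f g :: "'a::comm_ring_1 fps"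
  shows "fps_agree N f f' \<Longrightarrow> fps_agree N g g' \<Longrightarrow> fps_agree N (f + g) (f' + g')"
  by (simp add: fps_agree_def)

lemma fps_agree_diff:
  fixes f g :: "'a::comm_ring_1 fps"
  shows "fps_agree N f f' \<Longrightarrow> fps_agree N g g' \<Longrightarrow> fps_agree N (f - g) (f' - g')"
  by (simp add: fps_agree_def)

lemma fps_agree_mult:
  fixes f g :: "'a::comm_ring_1 fps"
  assumes "fps_agree N f f'" "fps_agree N g g'"
  shows "fps_agree N (f * g) (f' * g')"
  using assms by (auto simp: fps_agree_def fps_mult_nth intro!: sum.cong)

lemma fps_agree_prod:
  fixes f g :: "'b \<Rightarrow> 'a::comm_ring_1 fps"
  assumes "\<And>x. x \<in> A \<Longrightarrow> fps_agree N (f x) (g x)"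
  shows "fps_agree N (prod f A) (prod g A)"
  using assms by (induction A rule: infinite_finite_induct) (auto intro: fps_agree_mult)

lemma fps_agree_sum:
  fixes f g :: "'b \<Rightarrow> 'a::comm_ring_1 fps"
  assumes "\<And>x. x \<in> A \<Longrightarrow> fps_agree N (f x) (g x)"
  shows "fps_agree N (sum f A) (sum g A)"
  using assms by (induction A rule: infinite_finite_induct) (auto intro: fps_agree_add)

lemma fps_agree_inverse:
  fixes f g :: "'a::field fps"
  assumes "fps_agree N f g" "fps_nth f 0 \<noteq> 0" "fps_nth g 0 \<noteq> 0"
  shows "fps_agree N (inverse f) (inverse g)"
proof -
  have "fps_agree N (inverse f * g * inverse g) (inverse f * f * inverse g)"
    by (intro fps_agree_mult fps_agree_refl fps_agree_sym[OF assms(1)])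
  moreover have "inverse f * g * inverse g = inverse f"
    by (simp only: mult.assoc inverse_mult_eq_1'[OF assms(3)] mult_1_right)
  moreover have "inverse f * f * inverse g = inverse g"
    by (simp only: inverse_mult_eq_1[OF assms(2)] mult_1_left)
  ultimately show ?thesis by simp
qed

lemma fps_agree_X_power: "N \<le> n \<Longrightarrow> fps_agree N (fps_X ^ n * f) (0 :: 'a::comm_ring_1 fps)"
  by (auto simp: fps_agree_def fps_X_power_mult_nth)

lemma fps_agree_one_minus_X_power:
  "N \<le> n \<Longrightarrow> fps_agree N (1 - fps_X ^ n) (1 :: 'a::comm_ring_1 fps)"
  by (auto simp: fps_agree_def fps_X_power_nth)

lemma fps_agree_prod_one:
  assumes "\<And>m. m \<in> B \<Longrightarrow> N \<le> m"
  shows "fps_agree N (\<Prod>m\<in>B. 1 - fps_X ^ m) (1 :: 'a::comm_ring_1 fps)"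
  using fps_agree_prod[of B N "\<lambda>m. 1 - fps_X ^ m" "\<lambda>_. 1 :: 'a fps"]
    fps_agree_one_minus_X_power assms by fastforce

text \<open>Factors with m > n cannot influence coefficient n, so each coefficient is read off a
  finite product. Starting at 1 discards the exponent 0, whose factor would be zero; index sets such
  as the multiples of a number may therefore contain 0.\<close>

definition qprod :: "nat set \<Rightarrow> 'a::comm_ring_1 fps" where
  "qprod A = Abs_fps (\<lambda>n. fps_nth (\<Prod>m\<in>A \<inter> {1..n}. 1 - fps_X ^ m) n)"

text \<open>The surplus factors are 1 modulo X^N. The freedom in B matters because truncated index
  sets, such as dilates of an initial segment, are rarely initial segments of A themselves.\<close>

lemma qprod_agree:
  assumes "finite B" "B \<subseteq> A" "0 \<notin> B" "A \<inter> {1..<N} \<subseteq> B"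
  shows "fps_agree N (\<Prod>m\<in>B. 1 - fps_X ^ m) (qprod A :: 'a::comm_ring_1 fps)"
  unfolding fps_agree_def
proof (intro allI impI)
  fix n assume n: "n < N"
  let ?f = "\<lambda>m. 1 - fps_X ^ m :: 'a fps"
  have sub: "A \<inter> {1..n} \<subseteq> B"
    using assms(4) n by auto
  have "prod ?f B = prod ?f (B - A \<inter> {1..n}) * prod ?f (A \<inter> {1..n})"
    by (rule prod.subset_diff) (use sub assms in auto)
  moreover have "fps_agree (Suc n) (prod ?f (B - A \<inter> {1..n}) * prod ?f (A \<inter> {1..n}))
      (1 * prod ?f (A \<inter> {1..n}))"
  proof (intro fps_agree_mult fps_agree_refl fps_agree_prod_one)
    fix m assume "m \<in> B - A \<inter> {1..n}"
    then have "m \<noteq> 0" "\<not> (1 \<le> m \<and> m \<le> n)"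
      using assms by auto
    then show "Suc n \<le> m" by simp
  qed
  ultimately show "fps_nth (prod ?f B) n = fps_nth (qprod A) n"
    by (simp add: fps_agree_def qprod_def)
qed

lemma qprod_agree_atMost:
  "fps_agree N (\<Prod>m\<in>A \<inter> {1..N}. 1 - fps_X ^ m) (qprod A :: 'a::comm_ring_1 fps)"
  by (rule qprod_agree) auto

lemma qprod_nth_0 [simp]: "fps_nth (qprod A) 0 = 1"
  by (simp add: qprod_def)

lemma qprod_Un:
  assumes "A \<inter> B = {}"
  shows "qprod (A \<union> B) = (qprod A * qprod B :: 'a::comm_ring_1 fps)"
proof (rule fps_agree_eqI)
  fix N
  have "fps_agree N (qprod (A \<union> B)) (\<Prod>m\<in>(A \<union> B) \<inter> {1..N}. 1 - fps_X ^ m :: 'a fps)"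
    by (rule fps_agree_sym, rule qprod_agree_atMost)
  also have "(\<Prod>m\<in>(A \<union> B) \<inter> {1..N}. 1 - fps_X ^ m :: 'a fps) =
      (\<Prod>m\<in>A \<inter> {1..N}. 1 - fps_X ^ m) * (\<Prod>m\<in>B \<inter> {1..N}. 1 - fps_X ^ m)"
    by (subst prod.union_disjoint [symmetric]) (use assms in \<open>auto intro!: prod.cong\<close>)
  also have "fps_agree N \<dots> (qprod A * qprod B)"
    by (intro fps_agree_mult qprod_agree_atMost)
  finally show "fps_agree N (qprod (A \<union> B)) (qprod A * qprod B :: 'a fps)" .
qed

section \<open>Substituting X^k and -X into infinite products\<close>

lemma fps_agree_compose:
  fixes f g :: "'a::comm_ring_1 fps"
  assumes "fps_agree N f g" "fps_nth h 0 = 0"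
  shows "fps_agree N (f oo h) (g oo h)"
  using assms by (auto simp: fps_agree_def fps_compose_nth intro!: sum.cong)

lemma qprod_compose_X_power:
  assumes k: "k > 0"
  shows "qprod A oo fps_X ^ k = (qprod ((*) k ` A) :: 'a::idom fps)"
proof (rule fps_agree_eqI)
  fix N
  have k0: "fps_nth (fps_X ^ k :: 'a fps) 0 = 0"
    using k by simp
  have "(\<Prod>m\<in>A \<inter> {1..N}. 1 - fps_X ^ m :: 'a fps) oo fps_X ^ k
      = (\<Prod>m\<in>A \<inter> {1..N}. 1 - fps_X ^ (k * m))"
    by (simp add: fps_compose_prod_distrib[OF k0] fps_compose_sub_distrib fps_X_power_compose[OF k0]
        power_mult [symmetric])
  also have "\<dots> = (\<Prod>m\<in>(*) k ` (A \<inter> {1..N}). 1 - fps_X ^ m)"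
    using k by (subst prod.reindex) (auto simp: inj_on_def)
  finally have eq: "(\<Prod>m\<in>A \<inter> {1..N}. 1 - fps_X ^ m :: 'a fps) oo fps_X ^ k = \<dots>" .
  have "fps_agree N (\<Prod>m\<in>(*) k ` (A \<inter> {1..N}). 1 - fps_X ^ m) (qprod ((*) k ` A) :: 'a fps)"
  proof (rule qprod_agree)
    have "m \<le> N" if "k * m < N" for m
      using k that by (metis less_le_not_le mult_le_mono1 nat_mult_1 Suc_leI One_nat_def order.trans)
    then show "(*) k ` A \<inter> {1..<N} \<subseteq> (*) k ` (A \<inter> {1..N})"
      by (fastforce simp: Suc_le_eq)
  qed (use k in auto)
  moreover have "fps_agree N ((\<Prod>m\<in>A \<inter> {1..N}. 1 - fps_X ^ m :: 'a fps) oo fps_X ^ k)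
     (qprod A oo fps_X ^ k)"
    by (intro fps_agree_compose qprod_agree_atMost k0)
  ultimately show "fps_agree N (qprod A oo fps_X ^ k) (qprod ((*) k ` A) :: 'a fps)"
    unfolding eq by (rule fps_agree_trans[OF fps_agree_sym, rotated])
qed

lemma Eq_qprod:
  assumes "a > 0"
  shows "Eq a = qprod {m. a dvd m}"
proof (rule fps_ext)
  fix n
  have "(\<Prod>m\<in>{1..n}. 1 - fps_X ^ (a * m) :: rat fps) = (\<Prod>m\<in>(*) a ` {1..n}. 1 - fps_X ^ m)"
    using assms by (subst prod.reindex) (auto simp: inj_on_def)
  moreover have "fps_agree (Suc n) \<dots> (qprod {m. a dvd m} :: rat fps)"
  proof (rule qprod_agree)
    have "k \<le> n" if "a * k < Suc n" for k
      using assms that by (metis less_Suc_eq_le mult_le_mono1 nat_mult_1 Suc_leI One_nat_def order.trans)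
    then show "{m. a dvd m} \<inter> {1..<Suc n} \<subseteq> (*) a ` {1..n}"
      using assms by (auto simp: dvd_def intro!: imageI) 
  qed (use assms in auto)
  ultimately show "fps_nth (Eq a) n = fps_nth (qprod {m. a dvd m}) n"
    by (simp add: Eq_def fps_agree_def)
qed

lemma Eq_nth_0 [simp]: "fps_nth (Eq a) 0 = 1"
  by (simp add: Eq_def)

lemma Eq_nonzero [simp]: "Eq a \<noteq> 0"
  using Eq_nth_0[of a] by (metis fps_zero_nth zero_neq_one)

lemma Eq_compose_X_power:
  assumes "a > 0" "k > 0"
  shows "Eq a oo fps_X ^ k = Eq (k * a)"
proof -
  have "(*) k ` {m. a dvd m} = {m. k * a dvd m}"
    using assms by (auto simp: dvd_def image_def)
  then show ?thesis
    using assms by (simp add: Eq_qprod qprod_compose_X_power)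
qed

text \<open>For odd a this isolates the factors with odd exponent, the only ones that q -> -q
  affects.\<close>

lemma Eq_odd_even:
  assumes "a > 0"
  shows "Eq a = qprod ((*) a ` {m. odd m}) * Eq (2 * a)"
proof -
  have "{m. a dvd m} = (*) a ` {m. odd m} \<union> {m. 2 * a dvd m}"
  proof (intro equalityI subsetI)
    fix m assume "m \<in> {m. a dvd m}"
    then obtain k where "m = a * k" by auto
    then show "m \<in> (*) a ` {m. odd m} \<union> {m. 2 * a dvd m}"
      by (cases "even k") auto
  qed (auto dest: dvd_mult_right)
  moreover have "(*) a ` {m. odd m} \<inter> {m. 2 * a dvd m} = {}"
    using assms by (auto simp: dvd_def)
  ultimately show ?thesis
    using assms by (simp add: Eq_qprod qprod_Un)
qed

text \<open>For odd m the sign change gives 1 + X^m, and (1 + X^m)(1 - X^m) = 1 - X^(2m).\<close>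

lemma qprod_odd_compose_uminus:
  assumes "\<And>m. m \<in> A \<Longrightarrow> odd m"
  shows "(qprod A oo (- fps_X)) * qprod A = (qprod ((*) 2 ` A) :: 'a::idom fps)"
proof (rule fps_agree_eqI)
  fix N
  let ?p = "\<Prod>m\<in>A \<inter> {1..N}. 1 - fps_X ^ m :: 'a fps"
  have 0: "fps_nth (- fps_X :: 'a fps) 0 = 0" by simp
  have "?p oo (- fps_X) = (\<Prod>m\<in>A \<inter> {1..N}. 1 + fps_X ^ m)"
    using assms
    by (auto simp: fps_compose_prod_distrib[OF 0] fps_compose_sub_distrib
        fps_X_power_compose[OF 0] intro!: prod.cong)
  then have "(?p oo (- fps_X)) * ?p = (\<Prod>m\<in>A \<inter> {1..N}. 1 - fps_X ^ m oo fps_X ^ 2)"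
    by (auto simp: prod.distrib [symmetric] fps_compose_sub_distrib fps_X_power_compose
        algebra_simps power2_eq_square power_mult_distrib intro!: prod.cong)
  also have "\<dots> = ?p oo fps_X ^ 2"
    by (simp add: fps_compose_prod_distrib)
  finally have eq: "(?p oo (- fps_X)) * ?p = ?p oo fps_X ^ 2" .
  have "fps_agree N ((?p oo (- fps_X)) * ?p) ((qprod A oo (- fps_X)) * qprod A)"
    by (intro fps_agree_mult fps_agree_compose qprod_agree_atMost 0)
  moreover have "fps_agree N (?p oo fps_X ^ 2) (qprod A oo fps_X ^ 2)"
    by (intro fps_agree_compose qprod_agree_atMost) simp
  ultimately show "fps_agree N ((qprod A oo (- fps_X)) * qprod A) (qprod ((*) 2 ` A) :: 'a fps)"
    unfolding eq qprod_compose_X_power[OF zero_less_numeral]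
    by (rule fps_agree_trans[OF fps_agree_sym])
qed

lemma fps_even_compose_uminus:
  fixes f :: "'a::idom fps"
  shows "(f oo fps_X ^ 2) oo (- fps_X) = f oo fps_X ^ 2"
  by (simp add: fps_compose_assoc [symmetric] fps_X_power_compose)

lemma Eq_even_compose_uminus: "a > 0 \<Longrightarrow> Eq (2 * a) oo (- fps_X) = Eq (2 * a)"
  using fps_even_compose_uminus[of "Eq a"] by (simp add: Eq_compose_X_power)

text \<open>Write E_a = O_a E_(2a) with O_a the product over odd multiples of a. Then O_a(-q) O_a(q)
  = O_(2a) = E_(2a)/E_(4a). This is the classical formula for E(-q), cleared of
  denominators.\<close>

lemma Eq_odd_compose_uminus:
  assumes "odd a"
  shows "(Eq a oo (- fps_X)) * Eq a * Eq (4 * a) = Eq (2 * a) ^ 3"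
proof -
  have a: "a > 0" using assms by (simp add: odd_pos)
  let ?O = "(*) a ` {m. odd m}"
  have "Eq a oo (- fps_X) = (qprod ?O oo (- fps_X)) * Eq (2 * a)"
    using a by (subst Eq_odd_even) (simp_all add: fps_compose_mult_distrib Eq_even_compose_uminus)
  then have "(Eq a oo (- fps_X)) * Eq a = (qprod ?O oo (- fps_X)) * qprod ?O * Eq (2 * a) ^ 2"
    using Eq_odd_even[OF a] by (simp only: power2_eq_square mult_ac)
  also have "(qprod ?O oo (- fps_X)) * qprod ?O = (qprod ((*) 2 ` ?O) :: rat fps)"
    by (rule qprod_odd_compose_uminus) (use assms in auto)
  also have "(*) 2 ` ?O = (*) (2 * a) ` {m. odd m}"
    by (simp add: image_image mult.assoc)
  finally show ?thesis
    using Eq_odd_even[of "2 * a"] a by (simp add: power2_eq_square power3_eq_cube mult_ac)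
qed

section \<open>Partial fractions\<close>

text \<open>Indexing by the distance from i prepares the bilateral shape: the two halves become the
  positive and the negative indices.\<close>

lemma prod_around:
  fixes g :: "nat \<Rightarrow> 'a::comm_monoid_mult"
  assumes "i \<le> K"
  shows "(\<Prod>k\<in>{..K} - {i}. g k) = (\<Prod>l=1..K - i. g (i + l)) * (\<Prod>l=1..i. g (i - l))"
proof -
  have "{..K} - {i} = (\<lambda>l. i + l) ` {1..K - i} \<union> (\<lambda>l. i - l) ` {1..i}"
  proof (intro equalityI subsetI)
    fix k assume "k \<in> {..K} - {i}"
    then show "k \<in> (\<lambda>l. i + l) ` {1..K - i} \<union> (\<lambda>l. i - l) ` {1..i}"
      by (cases "k < i") (auto intro: image_eqI[of _ _ "i - k"] image_eqI[of _ _ "k - i"])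
  qed (use assms in auto)
  then have "(\<Prod>k\<in>{..K} - {i}. g k) =
      (\<Prod>k\<in>(\<lambda>l. i + l) ` {1..K - i}. g k) * (\<Prod>k\<in>(\<lambda>l. i - l) ` {1..i}. g k)"
    by (simp only:) (rule prod.union_disjoint, auto)
  moreover have "inj_on (\<lambda>l. i + l) {1..K - i}" "inj_on (\<lambda>l. i - l) {1..i}"
    by (auto simp: inj_on_def)
  ultimately show ?thesis
    by (simp only: prod.reindex o_def)
qed

lemma sum_around:
  fixes g :: "nat \<Rightarrow> 'a::comm_monoid_add"
  assumes "i \<le> K"
  shows "(\<Sum>k\<le>K. g k) = g i + (\<Sum>l=1..K - i. g (i + l)) + (\<Sum>l=1..i. g (i - l))"
proof -
  have "{..K} - {i} = (\<lambda>l. i + l) ` {1..K - i} \<union> (\<lambda>l. i - l) ` {1..i}"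
  proof (intro equalityI subsetI)
    fix k assume "k \<in> {..K} - {i}"
    then show "k \<in> (\<lambda>l. i + l) ` {1..K - i} \<union> (\<lambda>l. i - l) ` {1..i}"
      by (cases "k < i") (auto intro: image_eqI[of _ _ "i - k"] image_eqI[of _ _ "k - i"])
  qed (use assms in auto)
  then have "(\<Sum>k\<in>{..K} - {i}. g k) =
      (\<Sum>k\<in>(\<lambda>l. i + l) ` {1..K - i}. g k) + (\<Sum>k\<in>(\<lambda>l. i - l) ` {1..i}. g k)"
    by (simp only:) (rule sum.union_disjoint, auto)
  moreover have "(\<Sum>k\<le>K. g k) = g i + (\<Sum>k\<in>{..K} - {i}. g k)"
    using assms by (intro sum.remove) auto
  moreover have "inj_on (\<lambda>l. i + l) {1..K - i}" "inj_on (\<lambda>l. i - l) {1..i}"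
    by (auto simp: inj_on_def)
  ultimately show ?thesis
    by (simp only: sum.reindex o_def add.assoc)
qed

text \<open>Both sides are polynomials in t of degree at most \<open>card I\<close> that agree at 0
  and at every node, one point more than the degree allows. The factor x^(card I) is the value at t
  = 0 of the quotient of the two products, and the factor t makes every other term vanish there.
  Clearing denominators allows t to be a node.\<close>

lemma prod_linear_partial_fractions:
  fixes \<alpha> :: "'b \<Rightarrow> 'a::field"
  assumes fin: "finite I" and inj: "inj_on \<alpha> I" and nz: "\<And>i. i \<in> I \<Longrightarrow> \<alpha> i \<noteq> 0"
  shows "(\<Prod>i\<in>I. t - x * \<alpha> i) = x ^ card I * (\<Prod>i\<in>I. t - \<alpha> i) +
    (\<Sum>i\<in>I. (\<Prod>k\<in>I. \<alpha> i - x * \<alpha> k) / (\<alpha> i * (\<Prod>k\<in>I - {i}. \<alpha> i - \<alpha> k)) * t *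
      (\<Prod>k\<in>I - {i}. t - \<alpha> k))"
proof -
  define r where "r i = (\<Prod>k\<in>I. \<alpha> i - x * \<alpha> k) / (\<alpha> i * (\<Prod>k\<in>I - {i}. \<alpha> i - \<alpha> k))" for i
  define D where "D = (\<Prod>i\<in>I. [:- (x * \<alpha> i), 1:]) - smult (x ^ card I) (\<Prod>i\<in>I. [:- \<alpha> i, 1:]) -
    (\<Sum>i\<in>I. smult (r i) ([:0, 1:] * (\<Prod>k\<in>I - {i}. [:- \<alpha> k, 1:])))"
  have poly_D: "poly D t = (\<Prod>i\<in>I. t - x * \<alpha> i) - x ^ card I * (\<Prod>i\<in>I. t - \<alpha> i) -
      (\<Sum>i\<in>I. r i * t * (\<Prod>k\<in>I - {i}. t - \<alpha> k))" for t
    by (simp add: D_def poly_prod poly_sum mult_ac)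
  have deg_prod: "degree (\<Prod>i\<in>J. [:- c i, 1:]) \<le> card J" if "finite J" for J and c :: "'b \<Rightarrow> 'a"
    by (rule order.trans[OF degree_prod_sum_le]) (use that in auto)
  have "degree D \<le> card I"
    unfolding D_def
  proof (intro degree_diff_le degree_sum_le fin)
    fix i assume i: "i \<in> I"
    have "degree (smult (r i) ([:0, 1:] * (\<Prod>k\<in>I - {i}. [:- \<alpha> k, 1:]))) \<le>
        degree ([:0, 1:] :: 'a poly) + degree (\<Prod>k\<in>I - {i}. [:- \<alpha> k, 1:])"
      by (rule order.trans[OF degree_smult_le degree_mult_le])
    also have "\<dots> \<le> 1 + card (I - {i})"
      by (intro add_mono deg_prod) (simp_all add: fin)
    also have "\<dots> = card I"
      using i fin by (simp add: card_gt_0_iff) (metis Suc_pred card_gt_0_iff empty_iff)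
    finally show "degree (smult (r i) ([:0, 1:] * (\<Prod>k\<in>I - {i}. [:- \<alpha> k, 1:]))) \<le> card I" .
  qed (use deg_prod[OF fin, of "\<lambda>i. x * \<alpha> i"] deg_prod[OF fin, of \<alpha>] in \<open>auto intro: order.trans[OF degree_smult_le]\<close>)
  moreover have "poly D (\<alpha> j) = 0" if j: "j \<in> I" for j
  proof -
    have "(\<Sum>i\<in>I. r i * \<alpha> j * (\<Prod>k\<in>I - {i}. \<alpha> j - \<alpha> k)) =
        (\<Sum>i\<in>{j}. r i * \<alpha> j * (\<Prod>k\<in>I - {i}. \<alpha> j - \<alpha> k))"
      using fin j by (intro sum.mono_neutral_right) (auto intro!: prod_zero)
    also have "\<dots> = (\<Prod>k\<in>I. \<alpha> j - x * \<alpha> k)"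
      using fin inj j nz[OF j] by (auto simp: r_def inj_on_def)
    finally show ?thesis
      using fin j by (auto simp: poly_D intro!: prod_zero)
  qed
  moreover have "poly D 0 = 0"
    by (simp add: poly_D prod.distrib flip: mult_minus_right)
  ultimately have D0: "D = 0" if "D \<noteq> 0"
  proof -
    have "insert 0 (\<alpha> ` I) \<subseteq> {t. poly D t = 0}"
      using \<open>poly D 0 = 0\<close> \<open>\<And>j. j \<in> I \<Longrightarrow> poly D (\<alpha> j) = 0\<close> by auto
    then have "card (insert 0 (\<alpha> ` I)) \<le> degree D"
      using card_mono[OF poly_roots_finite[OF that]] card_poly_roots_bound[OF that] le_trans by blast
    moreover have "card (insert 0 (\<alpha> ` I)) = Suc (card I)"
      using fin nz by (subst card_insert_disjoint) (auto simp: card_image[OF inj])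
    ultimately show ?thesis using \<open>degree D \<le> card I\<close> by simp
  qed
  then show ?thesis
    using poly_D[of t] unfolding r_def [symmetric] by (cases "D = 0") (simp_all add: algebra_simps)
qed

text \<open>With $Q = q^c$, these are the partial fractions of $\prod_{n=-M}^{M} (1 - xyQ^n)/(1 - yQ^n)$ in $y$,
taken at $x = y = q$; the exponents are arranged such that no negative powers of $q$ occur.\<close>
lemma lambert_partial_fractions:
  fixes q :: "'a::field"
  assumes q0: "q \<noteq> 0" and q1: "\<And>n. n > 0 \<Longrightarrow> q ^ n \<noteq> 1" and c: "c \<ge> 3"
  defines "R \<equiv> \<lambda>i j. (1 - q) * (\<Prod>l=1..i. (1 - q ^ (c * l + 1)) / (1 - q ^ (c * l))) *
                    (\<Prod>l=1..j. (1 - q ^ (c * l - 1)) / (1 - q ^ (c * l)))"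
  shows "(1 - q\<^sup>2) / (1 - q) *
      (\<Prod>n=1..M. (1 - q ^ (c * n + 2)) / (1 - q ^ (c * n + 1))) *
      (\<Prod>n=1..M. (1 - q ^ (c * n - 2)) / (1 - q ^ (c * n - 1))) =
    q ^ (M + 1) + R M M / (1 - q) + (\<Sum>n=1..M. q ^ n / (1 - q ^ (c * n + 1)) * R (M - n) (M + n)) -
      (\<Sum>n=1..M. q ^ ((c - 1) * n - 1) / (1 - q ^ (c * n - 1)) * R (M + n) (M - n))"
proof -
  \<comment> \<open>The 2M + 1 nodes Q^n with -M <= n <= M are multiplied by Q^M to avoid negative
    exponents. With t = Q^M/q the factor t - u Q^(M+n) is t (1 - u q Q^n), which realises y = q; u =
    1 and u = q give denominator and numerator.\<close>
  define \<alpha> where "\<alpha> n = q ^ (c * n)" for n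
  define t where "t = \<alpha> M / q"
  define K where "K = 2 * M"
  have q_inj: "a = b" if "q ^ a = q ^ b" for a b
  proof -
    have *: "a = b" if "q ^ a = q ^ b" "a \<le> b" for a b
    proof -
      have "q ^ (b - a) = 1" using that q0 by (simp add: power_diff)
      then show ?thesis using q1[of "b - a"] that by force
    qed
    show ?thesis using *[of a b] *[of b a] that by (cases "a \<le> b") auto
  qed
  have \<alpha>0: "\<alpha> n \<noteq> 0" for n by (simp add: \<alpha>_def q0)
  have \<alpha>_inj: "\<alpha> a = \<alpha> b \<longleftrightarrow> a = b" for a b
    using c by (auto simp: \<alpha>_def dest: q_inj)
  have \<alpha>_add: "\<alpha> (a + b) = \<alpha> a * \<alpha> b" for a b
    by (simp add: \<alpha>_def distrib_left power_add)
  have \<alpha>1: "\<alpha> n \<noteq> 1" if "n > 0" for n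
    using q1[of "c * n"] c that by (simp add: \<alpha>_def)
  have t_add: "t - u * \<alpha> (M + n) = t * (1 - u * q ^ (c * n + 1))" for u n
    using q0 by (simp add: t_def \<alpha>_add) (simp add: \<alpha>_def field_simps)
  have q_pred: "q ^ (c * n - 1) = \<alpha> n / q" "q ^ (c * n - 2) = \<alpha> n / q\<^sup>2" if "n \<ge> 1" for n
  proof -
    have "c * n \<ge> 3" using c that by (metis mult_le_mono mult.right_neutral)
    then show "q ^ (c * n - 1) = \<alpha> n / q" "q ^ (c * n - 2) = \<alpha> n / q\<^sup>2"
      using power_diff[OF q0, of 1 "c * n"] power_diff[OF q0, of 2 "c * n"] c that by (simp_all add: \<alpha>_def)
  qed
  have t_diff: "t - u * \<alpha> (M - n) = \<alpha> (M - n) * (q ^ (c * n - 1) - u)" if "n \<in> {1..M}" for u n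
    using that \<alpha>_add[of "M - n" n] by (simp add: t_def q_pred algebra_simps del: One_nat_def)
  have ne_add: "1 - q ^ (c * n + 1) \<noteq> 0" for n
    using q1[of "c * n + 1"] by simp
  have ne_pred: "1 - q ^ (c * n - 1) \<noteq> 0" if "n \<ge> 1" for n
  proof -
    have "c * n \<ge> 3" using c that by (metis mult_le_mono mult.right_neutral)
    then show ?thesis using q1[of "c * n - 1"] by simp
  qed
  have ne_t: "t - \<alpha> i \<noteq> 0" for i
  proof -
    have "\<alpha> M \<noteq> q ^ (c * i + 1)"
    proof
      assume "\<alpha> M = q ^ (c * i + 1)"
      then have "c * M = c * i + 1" unfolding \<alpha>_def by (rule q_inj)
      then have "c dvd 1" by (metis dvd_add_right_iff dvd_triv_left)
      with c show False by simp
    qed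
    then show ?thesis using q0 by (simp add: t_def \<alpha>_def field_simps)
  qed
  have t0: "t \<noteq> 0" by (simp add: t_def \<alpha>0 q0)

  define r where "r i = (\<Prod>k\<in>{..K}. \<alpha> i - q * \<alpha> k) / (\<alpha> i * (\<Prod>k\<in>{..K} - {i}. \<alpha> i - \<alpha> k))" for i
  \<comment> \<open>Seen from node i, the other nodes lie at distances l above and below. Each of
    the i lower ones contributes one factor q, hence q^i.\<close>
  have r_R: "r i = q ^ i * R (K - i) i" if i: "i \<le> K" for i
  proof -
    have "r i = (\<alpha> i - q * \<alpha> i) / \<alpha> i * (\<Prod>k\<in>{..K} - {i}. (\<alpha> i - q * \<alpha> k) / (\<alpha> i - \<alpha> k))"
      unfolding r_def using i
      by (subst prod.remove[of _ i]) (simp_all add: prod_dividef)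
    also have "(\<alpha> i - q * \<alpha> i) / \<alpha> i = 1 - q"
      using \<alpha>0[of i] by (simp add: field_simps)
    also have "(\<Prod>k\<in>{..K} - {i}. (\<alpha> i - q * \<alpha> k) / (\<alpha> i - \<alpha> k)) =
        (\<Prod>l=1..K - i. (\<alpha> i - q * \<alpha> (i + l)) / (\<alpha> i - \<alpha> (i + l))) *
        (\<Prod>l=1..i. (\<alpha> i - q * \<alpha> (i - l)) / (\<alpha> i - \<alpha> (i - l)))"
      using i by (rule prod_around)
    also have "(\<Prod>l=1..K - i. (\<alpha> i - q * \<alpha> (i + l)) / (\<alpha> i - \<alpha> (i + l))) =
        (\<Prod>l=1..K - i. (1 - q ^ (c * l + 1)) / (1 - q ^ (c * l)))"
    proof (rule prod.cong)
      fix l assume "l \<in> {1..K - i}"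
      have "\<alpha> i - q * \<alpha> (i + l) = \<alpha> i * (1 - q ^ (c * l + 1))"
           "\<alpha> i - \<alpha> (i + l) = \<alpha> i * (1 - q ^ (c * l))"
        by (simp_all add: \<alpha>_add) (simp_all add: \<alpha>_def algebra_simps)
      then show "(\<alpha> i - q * \<alpha> (i + l)) / (\<alpha> i - \<alpha> (i + l)) = (1 - q ^ (c * l + 1)) / (1 - q ^ (c * l))"
        using \<alpha>0[of i] by simp
    qed simp
    also have "(\<Prod>l=1..i. (\<alpha> i - q * \<alpha> (i - l)) / (\<alpha> i - \<alpha> (i - l))) =
        (\<Prod>l=1..i. q * ((1 - q ^ (c * l - 1)) / (1 - q ^ (c * l))))"
    proof (rule prod.cong)
      fix l assume l: "l \<in> {1..i}"
      have e: "\<alpha> i = \<alpha> (i - l) * \<alpha> l" using l \<alpha>_add[of "i - l" l] by simp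
      have "\<alpha> i - q * \<alpha> (i - l) = \<alpha> (i - l) * (q * (- (1 - q ^ (c * l - 1))))"
        using q0 l by (simp add: e q_pred field_simps del: One_nat_def)
      moreover have "\<alpha> i - \<alpha> (i - l) = \<alpha> (i - l) * (- (1 - q ^ (c * l)))"
        by (simp add: e) (simp add: \<alpha>_def algebra_simps)
      ultimately have "(\<alpha> i - q * \<alpha> (i - l)) / (\<alpha> i - \<alpha> (i - l)) =
          (q * (- (1 - q ^ (c * l - 1)))) / (- (1 - q ^ (c * l)))"
        using \<alpha>0[of "i - l"] by (metis mult_divide_mult_cancel_left)
      also have "\<dots> = q * ((1 - q ^ (c * l - 1)) / (1 - q ^ (c * l)))"
        by (simp only: mult_minus_right minus_divide_divide times_divide_eq_right)
      finally show "(\<alpha> i - q * \<alpha> (i - l)) / (\<alpha> i - \<alpha> (i - l)) = \<dots>" .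
    qed simp
    finally show ?thesis
      by (simp add: R_def prod.distrib mult_ac del: times_divide_eq_right times_divide_eq_left)
  qed

  have "(\<Prod>i\<in>{..K}. t - q * \<alpha> i) = q ^ card {..K} * (\<Prod>i\<in>{..K}. t - \<alpha> i) +
      (\<Sum>i\<in>{..K}. r i * t * (\<Prod>k\<in>{..K} - {i}. t - \<alpha> k))"
    unfolding r_def by (rule prod_linear_partial_fractions) (auto simp: inj_on_def \<alpha>_inj \<alpha>0)
  also have "(\<Sum>i\<in>{..K}. r i * t * (\<Prod>k\<in>{..K} - {i}. t - \<alpha> k)) =
      (\<Sum>i\<in>{..K}. r i * (t / (t - \<alpha> i))) * (\<Prod>k\<in>{..K}. t - \<alpha> k)"
    unfolding sum_distrib_right
  proof (rule sum.cong)
    fix i assume "i \<in> {..K}"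
    then have "(\<Prod>k\<in>{..K}. t - \<alpha> k) = (t - \<alpha> i) * (\<Prod>k\<in>{..K} - {i}. t - \<alpha> k)"
      by (intro prod.remove) auto
    then show "r i * t * (\<Prod>k\<in>{..K} - {i}. t - \<alpha> k) =
        r i * (t / (t - \<alpha> i)) * (\<Prod>k\<in>{..K}. t - \<alpha> k)"
      using ne_t[of i] by simp
  qed simp
  finally have "(\<Prod>i\<in>{..K}. t - q * \<alpha> i) =
      (q ^ (K + 1) + (\<Sum>i\<in>{..K}. r i * (t / (t - \<alpha> i)))) * (\<Prod>i\<in>{..K}. t - \<alpha> i)"
    by (simp add: algebra_simps)
  moreover have "(\<Prod>i\<in>{..K}. t - \<alpha> i) \<noteq> 0" using ne_t by simp
  ultimately have main: "(\<Prod>i\<in>{..K}. (t - q * \<alpha> i) / (t - \<alpha> i)) =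
      q ^ (K + 1) + (\<Sum>i\<in>{..K}. r i * (t / (t - \<alpha> i)))"
    by (simp add: prod_dividef)

  have quot_add: "(t - q * \<alpha> (M + n)) / (t - \<alpha> (M + n)) = (1 - q ^ (c * n + 2)) / (1 - q ^ (c * n + 1))" for n
    using t_add[of q n] t_add[of 1 n] t0 by (simp add: mult.commute)
  have quot_diff: "(t - q * \<alpha> (M - n)) / (t - \<alpha> (M - n)) =
      q * ((1 - q ^ (c * n - 2)) / (1 - q ^ (c * n - 1)))" if n: "n \<in> {1..M}" for n
  proof -
    have "(t - q * \<alpha> (M - n)) / (t - \<alpha> (M - n)) = (q ^ (c * n - 1) - q) / (q ^ (c * n - 1) - 1)"
      using t_diff[OF n, of q] t_diff[OF n, of 1] \<alpha>0[of "M - n"] by simp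
    also have "q ^ (c * n - 1) - q = - (q * (1 - q ^ (c * n - 2)))"
      using n q0 by (simp add: q_pred field_simps power2_eq_square del: One_nat_def)
    also have "q ^ (c * n - 1) - 1 = - (1 - q ^ (c * n - 1))" by simp
    finally show ?thesis by (simp only: minus_divide_divide times_divide_eq_right)
  qed
  have "(\<Prod>i\<in>{..K}. (t - q * \<alpha> i) / (t - \<alpha> i)) = (t - q * \<alpha> M) / (t - \<alpha> M) *
      ((\<Prod>l=1..K - M. (t - q * \<alpha> (M + l)) / (t - \<alpha> (M + l))) *
       (\<Prod>l=1..M. (t - q * \<alpha> (M - l)) / (t - \<alpha> (M - l))))"
    by (subst prod.remove[of _ M], simp, simp add: K_def, subst prod_around) (simp_all add: K_def)
  also have "\<dots> = (1 - q\<^sup>2) / (1 - q) * ((\<Prod>l=1..M. (1 - q ^ (c * l + 2)) / (1 - q ^ (c * l + 1))) *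
       (\<Prod>l=1..M. q * ((1 - q ^ (c * l - 2)) / (1 - q ^ (c * l - 1)))))"
    using quot_add[of 0] by (simp add: quot_add quot_diff K_def power2_eq_square)
  finally have lhs: "(\<Prod>i\<in>{..K}. (t - q * \<alpha> i) / (t - \<alpha> i)) = q ^ M * ((1 - q\<^sup>2) / (1 - q) *
      (\<Prod>n=1..M. (1 - q ^ (c * n + 2)) / (1 - q ^ (c * n + 1))) *
      (\<Prod>n=1..M. (1 - q ^ (c * n - 2)) / (1 - q ^ (c * n - 1))))"
    by (simp add: prod.distrib mult_ac del: times_divide_eq_right times_divide_eq_left)

  have term_add: "r (M + n) * (t / (t - \<alpha> (M + n))) =
      q ^ M * (q ^ n / (1 - q ^ (c * n + 1)) * R (M - n) (M + n))" if "n \<le> M" for n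
    using that t_add[of 1 n] t0 r_R[of "M + n"] by (simp add: K_def power_add)
  have term_diff: "r (M - n) * (t / (t - \<alpha> (M - n))) =
      - (q ^ M * (q ^ ((c - 1) * n - 1) / (1 - q ^ (c * n - 1)) * R (M + n) (M - n)))" if n: "n \<in> {1..M}" for n
  proof -
    have "t = \<alpha> (M - n) * q ^ (c * n - 1)"
      using t_diff[OF n, of 0] by simp
    then have "t / (t - \<alpha> (M - n)) = q ^ (c * n - 1) / (q ^ (c * n - 1) - 1)"
      using t_diff[OF n, of 1] \<alpha>0[of "M - n"] by (metis mult_1_left mult_divide_mult_cancel_left)
    also have "q ^ (c * n - 1) - 1 = - (1 - q ^ (c * n - 1))" by simp
    finally have "t / (t - \<alpha> (M - n)) = - (q ^ (c * n - 1) / (1 - q ^ (c * n - 1)))"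
      by (simp only: divide_minus_right)
    moreover have "q ^ (M - n) * q ^ (c * n - 1) = q ^ M * q ^ ((c - 1) * n - 1)"
    proof -
      have "(c - 1) * n \<ge> 1" using c n by (auto simp: Suc_le_eq)
      moreover have "c * n = (c - 1) * n + n" using c by (simp add: diff_mult_distrib)
      ultimately have "M - n + (c * n - 1) = M + ((c - 1) * n - 1)" using n by auto
      then show ?thesis by (simp flip: power_add)
    qed
    moreover have "r (M - n) = q ^ (M - n) * R (M + n) (M - n)"
      using n r_R[of "M - n"] by (simp add: K_def)
    ultimately show ?thesis
      by (simp add: mult_ac)
  qed
  have "(\<Sum>i\<in>{..K}. r i * (t / (t - \<alpha> i))) = r M * (t / (t - \<alpha> M)) +
      (\<Sum>l=1..K - M. r (M + l) * (t / (t - \<alpha> (M + l)))) + (\<Sum>l=1..M. r (M - l) * (t / (t - \<alpha> (M - l))))"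
    by (rule sum_around) (simp add: K_def)
  also have "\<dots> = q ^ M * (R M M / (1 - q)) +
      (\<Sum>n=1..M. q ^ M * (q ^ n / (1 - q ^ (c * n + 1)) * R (M - n) (M + n))) +
      (\<Sum>n=1..M. - (q ^ M * (q ^ ((c - 1) * n - 1) / (1 - q ^ (c * n - 1)) * R (M + n) (M - n))))"
  proof (intro arg_cong2[where f = "(+)"] sum.cong term_add term_diff)
    show "r M * (t / (t - \<alpha> M)) = q ^ M * (R M M / (1 - q))"
      using term_add[of 0] by simp
  qed (auto simp: K_def)
  finally have sum_eq: "(\<Sum>i\<in>{..K}. r i * (t / (t - \<alpha> i))) = \<dots>" .
  have rhs: "q ^ (K + 1) + (\<Sum>i\<in>{..K}. r i * (t / (t - \<alpha> i))) =
    q ^ M * (q ^ (M + 1) + R M M / (1 - q) + (\<Sum>n=1..M. q ^ n / (1 - q ^ (c * n + 1)) * R (M - n) (M + n)) -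
      (\<Sum>n=1..M. q ^ ((c - 1) * n - 1) / (1 - q ^ (c * n - 1)) * R (M + n) (M - n)))"
  proof -
    have "q ^ (K + 1) = q ^ M * q ^ (M + 1)"
      by (simp add: K_def mult_2 power_add)
    with sum_eq show ?thesis
      by (simp only: sum_negf sum_distrib_left [symmetric] distrib_left right_diff_distrib
          add_uminus_conv_diff add.assoc add_diff_eq)
  qed
  have "q ^ M \<noteq> 0" using q0 by simp
  then show ?thesis
    using main unfolding lhs rhs by (rule mult_left_cancel[THEN iffD1])
qed

section \<open>Lambert series\<close>

lemma fps_to_fls_inverse:
  fixes f :: "'a::field fps"
  assumes "fps_nth f 0 \<noteq> 0"
  shows "fps_to_fls (inverse f) = inverse (fps_to_fls f)"
proof -
  have "fps_to_fls (inverse f) * fps_to_fls f = 1"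
    using inverse_mult_eq_1[OF assms] by (simp flip: fls_times_fps_to_fls)
  then show ?thesis by (metis inverse_unique inverse_inverse_eq)
qed

lemma fps_to_fls_prod:
  fixes f :: "'b \<Rightarrow> 'a::comm_ring_1 fps"
  shows "fps_to_fls (prod f A) = (\<Prod>x\<in>A. fps_to_fls (f x))"
  by (induction A rule: infinite_finite_induct) (simp_all add: fls_times_fps_to_fls)

lemma fps_to_fls_sum:
  fixes f :: "'b \<Rightarrow> 'a::comm_ring_1 fps"
  shows "fps_to_fls (sum f A) = (\<Sum>x\<in>A. fps_to_fls (f x))"
  by (induction A rule: infinite_finite_induct) simp_all

lemma fls_X_power_neq_1: "n > 0 \<Longrightarrow> (fls_X :: 'a::field fls) ^ n \<noteq> 1"
proof
  assume "n > 0" "(fls_X :: 'a fls) ^ n = 1"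
  then have "fps_to_fls (fps_X ^ n :: 'a fps) = fps_to_fls 1"
    by (simp add: fps_to_fls_power)
  then have "fps_X ^ n = (1 :: 'a fps)" by (simp only: fps_to_fls_eq_iff)
  then have "fps_nth (fps_X ^ n :: 'a fps) n = fps_nth 1 n" by (simp only:)
  with \<open>n > 0\<close> show False by (simp only: fps_X_power_nth fps_one_nth) simp
qed

text \<open>The finite q-Pochhammer symbol (q^r; q^c)_M, over any ring so that it can be evaluated
  both at \<open>fps_X\<close> and at \<open>fls_X\<close>.\<close>

definition qpoch :: "'a::comm_ring_1 \<Rightarrow> nat \<Rightarrow> nat \<Rightarrow> nat \<Rightarrow> 'a" where
  "qpoch q c r M = (\<Prod>n<M. 1 - q ^ (c * n + r))"

lemma qpoch_Suc_shift:
  "(1 - q ^ r) * (\<Prod>n=1..M. 1 - q ^ (c * n + r)) = qpoch q c r (Suc M)"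
  unfolding qpoch_def prod.lessThan_Suc_shift by (simp add: prod.atLeast1_atMost_eq)

lemma qpoch_minus_shift:
  assumes "r \<le> c"
  shows "(\<Prod>n=1..M. 1 - q ^ (c * n - r)) = qpoch q c (c - r) M"
proof -
  have "c * Suc n - r = c * n + (c - r)" for n
    using assms by simp
  then show ?thesis
    by (simp add: qpoch_def prod.atLeast1_atMost_eq)
qed

text \<open>The middle term becomes n = 0 of the first sum, and the negative half is shifted to
  start at 0, so that truncated subtraction survives only in constants and in the arguments of
  R.\<close>

lemma lambert_partial_fractions_qpoch:
  fixes q :: "'a::field"
  assumes q0: "q \<noteq> 0" and q1: "\<And>n. n > 0 \<Longrightarrow> q ^ n \<noteq> 1" and c: "c \<ge> 3"
  defines "R \<equiv> \<lambda>i j. qpoch q c 1 (Suc i) * qpoch q c (c - 1) j / (qpoch q c c i * qpoch q c c j)"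
  shows "qpoch q c 2 (Suc M) * qpoch q c (c - 2) M / (qpoch q c 1 (Suc M) * qpoch q c (c - 1) M) =
    q ^ (M + 1) + (\<Sum>n\<le>M. q ^ n / (1 - q ^ (c * n + 1)) * R (M - n) (M + n)) -
      (\<Sum>n<M. q ^ ((c - 1) * n + (c - 2)) / (1 - q ^ (c * n + (c - 1))) * R (Suc (M + n)) (M - Suc n))"
proof -
  have R: "(1 - q) * (\<Prod>l=1..i. (1 - q ^ (c * l + 1)) / (1 - q ^ (c * l))) *
      (\<Prod>l=1..j. (1 - q ^ (c * l - 1)) / (1 - q ^ (c * l))) = R i j" for i j
    using qpoch_Suc_shift[of q 1 c i] qpoch_minus_shift[of 1 c q j]
      qpoch_minus_shift[of 0 c q i] qpoch_minus_shift[of 0 c q j] c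
    by (simp add: R_def prod_dividef del: One_nat_def)
  have "(1 - q\<^sup>2) / (1 - q) *
      (\<Prod>n=1..M. (1 - q ^ (c * n + 2)) / (1 - q ^ (c * n + 1))) *
      (\<Prod>n=1..M. (1 - q ^ (c * n - 2)) / (1 - q ^ (c * n - 1))) =
      ((1 - q ^ 2) * (\<Prod>n=1..M. 1 - q ^ (c * n + 2))) * (\<Prod>n=1..M. 1 - q ^ (c * n - 2)) /
      (((1 - q ^ 1) * (\<Prod>n=1..M. 1 - q ^ (c * n + 1))) * (\<Prod>n=1..M. 1 - q ^ (c * n - 1)))"
    by (simp add: prod_dividef)
  also have "\<dots> = qpoch q c 2 (Suc M) * qpoch q c (c - 2) M / (qpoch q c 1 (Suc M) * qpoch q c (c - 1) M)"
    using c by (simp only: qpoch_Suc_shift) (simp add: qpoch_minus_shift del: One_nat_def)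
  finally have lhs: "(1 - q\<^sup>2) / (1 - q) *
      (\<Prod>n=1..M. (1 - q ^ (c * n + 2)) / (1 - q ^ (c * n + 1))) *
      (\<Prod>n=1..M. (1 - q ^ (c * n - 2)) / (1 - q ^ (c * n - 1))) = \<dots>" .
  have "(\<Sum>n\<le>M. q ^ n / (1 - q ^ (c * n + 1)) * R (M - n) (M + n)) =
      R M M / (1 - q) + (\<Sum>n=1..M. q ^ n / (1 - q ^ (c * n + 1)) * R (M - n) (M + n))"
    by (simp add: atMost_atLeast0 sum.atLeast_Suc_atMost[of 0])
  moreover have "(\<Sum>n=1..M. q ^ ((c - 1) * n - 1) / (1 - q ^ (c * n - 1)) * R (M + n) (M - n)) =
      (\<Sum>n<M. q ^ ((c - 1) * n + (c - 2)) / (1 - q ^ (c * n + (c - 1))) * R (Suc (M + n)) (M - Suc n))"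
  proof -
    have "(c - 1) * Suc n - 1 = (c - 1) * n + (c - 2)" "c * Suc n - 1 = c * n + (c - 1)" for n
      using c by simp_all
    then show ?thesis
      by (simp add: sum.atLeast1_atMost_eq)
  qed
  ultimately show ?thesis
    using lambert_partial_fractions[OF q0 q1 c, of M] unfolding R lhs
    by simp
qed

abbreviation fps_qpoch :: "nat \<Rightarrow> nat \<Rightarrow> nat \<Rightarrow> rat fps" where
  "fps_qpoch \<equiv> qpoch fps_X"

lemma fps_qpoch_nth_0: "r > 0 \<Longrightarrow> fps_nth (fps_qpoch c r M) 0 = 1"
  by (induction M) (simp_all add: qpoch_def fps_X_power_nth)

lemma fps_to_fls_qpoch: "fps_to_fls (fps_qpoch c r M) = qpoch fls_X c r M"
  by (simp add: qpoch_def fps_to_fls_prod fps_to_fls_power)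

text \<open>The infinite symbol (q^r; q^c) over one residue class.\<close>

definition qres :: "nat \<Rightarrow> nat \<Rightarrow> rat fps" where
  "qres c r = qprod (range (\<lambda>n. c * n + r))"

lemma qres_nth_0 [simp]: "fps_nth (qres c r) 0 = 1"
  by (simp add: qres_def)

lemma fps_qpoch_agree:
  assumes "c > 0" "r > 0" "N \<le> M"
  shows "fps_agree N (fps_qpoch c r M) (qres c r)"
proof -
  have "fps_qpoch c r M = (\<Prod>m\<in>(\<lambda>n. c * n + r) ` {..<M}. 1 - fps_X ^ m)"
    using assms by (subst prod.reindex) (auto simp: inj_on_def qpoch_def)
  moreover have "fps_agree N \<dots> (qres c r)"
    unfolding qres_def
  proof (rule qprod_agree)
    have "n < M" if "c * n + r < N" for n
    proof -
      have "n \<le> c * n" using assms by simp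
      then show ?thesis using that assms by linarith
    qed
    then show "range (\<lambda>n. c * n + r) \<inter> {1..<N} \<subseteq> (\<lambda>n. c * n + r) ` {..<M}"
      by auto
  qed (use assms in auto)
  ultimately show ?thesis by simp
qed

text \<open>In the field of Laurent series X is nonzero and not a root of unity, so the rational
  identity applies. All denominators have constant term 1, so both sides are power series, and the
  embedding is injective.\<close>

lemma lambert_fps_finite:
  assumes c: "c \<ge> 3"
  defines "R \<equiv> \<lambda>i j. fps_qpoch c 1 (Suc i) * fps_qpoch c (c - 1) j * inverse (fps_qpoch c c i * fps_qpoch c c j)"
  shows "fps_qpoch c 2 (Suc M) * fps_qpoch c (c - 2) M * inverse (fps_qpoch c 1 (Suc M) * fps_qpoch c (c - 1) M) =
    fps_X ^ (M + 1) + (\<Sum>n\<le>M. fps_X ^ n * inverse (1 - fps_X ^ (c * n + 1)) * R (M - n) (M + n)) -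
      (\<Sum>n<M. fps_X ^ ((c - 1) * n + (c - 2)) * inverse (1 - fps_X ^ (c * n + (c - 1))) * R (Suc (M + n)) (M - Suc n))"
    (is "?l = ?r")
proof -
  have "fps_to_fls ?l = fps_to_fls ?r"
    using lambert_partial_fractions_qpoch[where q = "fls_X :: rat fls", OF _ fls_X_power_neq_1 c, of M] c
    by (simp add: R_def fps_to_fls_inverse fps_to_fls_sum fls_times_fps_to_fls fps_to_fls_power
        fps_to_fls_qpoch fps_qpoch_nth_0 divide_inverse del: power_Suc)
  then show ?thesis by (simp only: fps_to_fls_eq_iff)
qed

text \<open>The coefficients of the bilateral series of q^n/(1 - q^(cn+1)) over all integers n. For
  n = -(m+1) the term equals -q^((c-1)m + c-2)/(1 - q^(cm + c-1)), which yields the divisors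
  congruent to -1.\<close>

definition lambert :: "nat \<Rightarrow> rat fps" where
  "lambert c = Abs_fps (\<lambda>k. of_nat (card {d. d dvd c * k + 1 \<and> d mod c = 1}) -
                            of_nat (card {d. d dvd c * k + 1 \<and> d mod c = c - 1}))"

lemma fps_inverse_one_minus_X_power_nth:
  assumes "m > 0"
  shows "fps_nth (inverse (1 - fps_X ^ m) :: rat fps) j = of_bool (m dvd j)"
proof -
  have "(1 - fps_X ^ m) * Abs_fps (\<lambda>j. of_bool (m dvd j)) = (1 :: rat fps)"
  proof (rule fps_ext)
    fix j
    show "fps_nth ((1 - fps_X ^ m) * Abs_fps (\<lambda>j. of_bool (m dvd j))) j = fps_nth (1 :: rat fps) j"
      using assms by (auto simp: left_diff_distrib fps_X_power_mult_nth dest: dvd_imp_le dvd_diffD)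
  qed
  then have "inverse (1 - fps_X ^ m) = (Abs_fps (\<lambda>j. of_bool (m dvd j)) :: rat fps)"
    by (rule fps_inverse_unique)
  then show ?thesis by simp
qed

text \<open>Expanding geometrically, n + (cn+1)j = k holds iff (cn+1)(cj+1) = ck+1. Such n are at
  most k, so cutting the sum at N > k loses nothing.\<close>

lemma lambert_sum_pos:
  assumes c: "c \<ge> 3" and k: "k < N"
  shows "fps_nth (\<Sum>n<N. fps_X ^ n * inverse (1 - fps_X ^ (c * n + 1)) :: rat fps) k =
    of_nat (card {d. d dvd c * k + 1 \<and> d mod c = 1})"
proof -
  have dvd: "(c * n + 1) dvd (k - n) \<longleftrightarrow> (c * n + 1) dvd (c * k + 1)" if "n \<le> k" for n
  proof -
    have "c * k + 1 = c * (k - n) + (c * n + 1)"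
      using that by (simp add: diff_mult_distrib2)
    then have "(c * n + 1) dvd (c * k + 1) \<longleftrightarrow> (c * n + 1) dvd c * (k - n)"
      by (simp only: dvd_add_left_iff dvd_refl)
    moreover have "coprime (c * n + 1) c"
      by (rule coprimeI) (metis dvd_add_right_iff dvd_mult2)
    ultimately show ?thesis by (simp add: coprime_dvd_mult_right_iff)
  qed
  have "fps_nth (\<Sum>n<N. fps_X ^ n * inverse (1 - fps_X ^ (c * n + 1)) :: rat fps) k =
      (\<Sum>n<N. of_bool (n \<le> k \<and> (c * n + 1) dvd (c * k + 1)))"
    unfolding fps_sum_nth
    by (rule sum.cong)
       (use dvd in \<open>auto simp: fps_X_power_mult_nth fps_inverse_one_minus_X_power_nth simp del: One_nat_def add_Suc_right\<close>)
  also have "\<dots> = of_nat (card {n. n < N \<and> n \<le> k \<and> (c * n + 1) dvd (c * k + 1)})"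
    by (simp add: sum.If_cases Int_def lessThan_def of_bool_def conj_ac)
  also have "card {n. n < N \<and> n \<le> k \<and> (c * n + 1) dvd (c * k + 1)} = 
      card {d. d dvd c * k + 1 \<and> d mod c = 1}"
  proof (rule bij_betw_same_card, rule bij_betw_imageI)
    show "inj_on (\<lambda>n. c * n + 1) {n. n < N \<and> n \<le> k \<and> (c * n + 1) dvd (c * k + 1)}"
      using c by (auto simp: inj_on_def)
    show "(\<lambda>n. c * n + 1) ` {n. n < N \<and> n \<le> k \<and> (c * n + 1) dvd (c * k + 1)} =
        {d. d dvd c * k + 1 \<and> d mod c = 1}"
    proof (intro equalityI subsetI)
      fix d assume "d \<in> {d. d dvd c * k + 1 \<and> d mod c = 1}"
      then have d: "d dvd c * k + 1" "d mod c = 1" by auto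
      then have "d = c * (d div c) + 1" by (metis mult_div_mod_eq)
      moreover have "d \<le> c * k + 1" using d by (auto intro: dvd_imp_le)
      ultimately have "c * (d div c) \<le> c * k" by linarith
      then have "d div c \<le> k" using c by simp
      then show "d \<in> (\<lambda>n. c * n + 1) ` {n. n < N \<and> n \<le> k \<and> (c * n + 1) dvd (c * k + 1)}"
        using d k \<open>d = c * (d div c) + 1\<close> by (intro image_eqI[of _ _ "d div c"]) auto
    qed (use c in \<open>auto simp: mod_Suc\<close>)
  qed
  finally show ?thesis .
qed

text \<open>Here (c-1)n + (c-2) + (cn+c-1)j = k holds iff (cn+c-1)(cj+c-1) = ck+1.\<close>

lemma lambert_sum_neg:
  assumes c: "c \<ge> 3" and k: "k < N"
  shows "fps_nth (\<Sum>n<N. fps_X ^ ((c - 1) * n + (c - 2)) * inverse (1 - fps_X ^ (c * n + (c - 1))) :: rat fps) k =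
    of_nat (card {d. d dvd c * k + 1 \<and> d mod c = c - 1})"
proof -
  have e: "(c - 1) * (c * n + (c - 1)) = c * ((c - 1) * n + (c - 2)) + 1" for n
  proof -
    obtain b where "c = b + 3" using c by (metis add.commute le_Suc_ex)
    then show ?thesis by (simp add: algebra_simps)
  qed
  have dvd: "(c * n + (c - 1)) dvd (k - ((c - 1) * n + (c - 2))) \<longleftrightarrow> (c * n + (c - 1)) dvd (c * k + 1)"
    if "(c - 1) * n + (c - 2) \<le> k" for n
  proof -
    have "c * k + 1 = c * (k - ((c - 1) * n + (c - 2))) + (c * ((c - 1) * n + (c - 2)) + 1)"
      using that mult_le_mono2[OF that, of c] by (simp add: diff_mult_distrib2 del: add_Suc_right)
    also have "\<dots> = c * (k - ((c - 1) * n + (c - 2))) + (c - 1) * (c * n + (c - 1))"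
      by (simp only: e)
    finally have "(c * n + (c - 1)) dvd (c * k + 1) \<longleftrightarrow>
        (c * n + (c - 1)) dvd c * (k - ((c - 1) * n + (c - 2)))"
      by (simp only: dvd_add_left_iff dvd_triv_right)
    moreover have "coprime (c * n + (c - 1)) c"
    proof (rule coprimeI)
      fix d assume d: "d dvd c * n + (c - 1)" "d dvd c"
      have "c * n + (c - 1) + 1 = c * (n + 1)" using c by simp
      with d show "d dvd 1" by (metis dvd_add_right_iff dvd_mult2)
    qed
    ultimately show ?thesis by (simp add: coprime_dvd_mult_right_iff)
  qed
  have "fps_nth (\<Sum>n<N. fps_X ^ ((c - 1) * n + (c - 2)) * inverse (1 - fps_X ^ (c * n + (c - 1))) :: rat fps) k =
      (\<Sum>n<N. of_bool ((c - 1) * n + (c - 2) \<le> k \<and> (c * n + (c - 1)) dvd (c * k + 1)))"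
    unfolding fps_sum_nth
  proof (rule sum.cong)
    fix n
    have "c * n + (c - 1) > 0" using c by simp
    then show "fps_nth (fps_X ^ ((c - 1) * n + (c - 2)) * inverse (1 - fps_X ^ (c * n + (c - 1))) :: rat fps) k =
       of_bool ((c - 1) * n + (c - 2) \<le> k \<and> (c * n + (c - 1)) dvd (c * k + 1))"
      using dvd[of n] by (simp only: fps_X_power_mult_nth fps_inverse_one_minus_X_power_nth) auto
  qed simp
  also have "\<dots> = of_nat (card {n. n < N \<and> (c - 1) * n + (c - 2) \<le> k \<and> (c * n + (c - 1)) dvd (c * k + 1)})"
    by (simp add: sum.If_cases Int_def lessThan_def of_bool_def conj_ac)
  also have "card {n. n < N \<and> (c - 1) * n + (c - 2) \<le> k \<and> (c * n + (c - 1)) dvd (c * k + 1)} =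
      card {d. d dvd c * k + 1 \<and> d mod c = c - 1}"
  proof (rule bij_betw_same_card, rule bij_betw_imageI)
    let ?S = "{n. n < N \<and> (c - 1) * n + (c - 2) \<le> k \<and> (c * n + (c - 1)) dvd (c * k + 1)}"
    show "inj_on (\<lambda>n. c * n + (c - 1)) ?S"
    proof (rule inj_onI)
      fix x y assume "c * x + (c - 1) = c * y + (c - 1)"
      then have "c * x = c * y" by (simp only: add_right_cancel)
      then show "x = y" using c by simp
    qed
    show "(\<lambda>n. c * n + (c - 1)) ` ?S = {d. d dvd c * k + 1 \<and> d mod c = c - 1}"
    proof (intro equalityI subsetI)
      fix d assume "d \<in> {d. d dvd c * k + 1 \<and> d mod c = c - 1}"
      then have d: "d dvd c * k + 1" "d mod c = c - 1" by auto
      define n where "n = d div c"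
      have dn: "d = c * n + (c - 1)" using d unfolding n_def by (metis mult_div_mod_eq)
      obtain b where b: "c * k + 1 = d * b" using d by blast
      \<comment> \<open>A divisor that is -1 modulo c has a cofactor that is also -1, hence at least
        c - 1. This is what bounds n.\<close>
      have "b mod c = c - 1"
      proof -
        have "d + 1 = c * (n + 1)" using dn c by simp
        then have "d * b + b = c * ((n + 1) * b)" by (metis add_mult_distrib mult.assoc mult_1)
        then have "c * k + (b + 1) = c * ((n + 1) * b)" using b by simp
        then have "c dvd b + 1" by (metis dvd_add_right_iff dvd_triv_left)
        then obtain e where "b + 1 = c * e" by blast
        moreover from this obtain e' where "e = Suc e'" by (cases e) auto
        ultimately have "b = c * e' + (c - 1)" using c by simp
        moreover have "c - 1 < c" using c by simp
        ultimately show ?thesis by (simp only: mod_mult_self4 mod_less)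
      qed
      then have "c - 1 \<le> b" by (metis mod_less_eq_dividend)
      then have "(c - 1) * d \<le> c * k + 1" unfolding b by (metis mult.commute mult_le_mono1)
      then have "c * ((c - 1) * n + (c - 2)) \<le> c * k" by (simp only: dn e add_le_cancel_right)
      then have le: "(c - 1) * n + (c - 2) \<le> k" using c by simp
      moreover have "n \<le> (c - 1) * n" using c by auto
      ultimately have "n < N" using k by linarith
      then show "d \<in> (\<lambda>n. c * n + (c - 1)) ` ?S"
        using d dn le by (intro image_eqI[of _ _ n]) auto
    next
      fix d assume "d \<in> (\<lambda>n. c * n + (c - 1)) ` ?S"
      then obtain n where "n \<in> ?S" "d = c * n + (c - 1)" by blast
      moreover have "c - 1 < c" using c by simp
      ultimately show "d \<in> {d. d dvd c * k + 1 \<and> d mod c = c - 1}"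
        by (simp only: mem_Collect_eq mod_mult_self4 mod_less)
    qed
  qed
  finally show ?thesis .
qed

text \<open>The case $x = y = q$ of Kronecker's identity
$\frac{(Q)_\infty^2 (xy)_\infty (Q/xy)_\infty}{(x)_\infty (Q/x)_\infty (y)_\infty (Q/y)_\infty}
= \sum_{n} x^n/(1 - y Q^n)$ with base $Q = q^c$.\<close>
theorem lambert_product:
  assumes c: "c \<ge> 3"
  shows "qres c 2 * qres c (c - 2) * inverse (qres c 1 * qres c (c - 1)) =
    qres c 1 * qres c (c - 1) * inverse (qres c c * qres c c) * lambert c"
proof (rule fps_agree_eqI)
  fix N :: nat
  \<comment> \<open>With M = 2N every n < N leaves both indices of R at least N, so R has reached
    its limit modulo X^N, while the terms with n >= N vanish modulo X^N.\<close>
  define M where "M = 2 * N"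
  define R where "R i j = fps_qpoch c 1 (Suc i) * fps_qpoch c (c - 1) j *
    inverse (fps_qpoch c c i * fps_qpoch c c j)" for i j
  define R' where "R' = qres c 1 * qres c (c - 1) * inverse (qres c c * qres c c)"
  have R: "fps_agree N (R i j) R'" if "N \<le> i" "N \<le> j" for i j
    unfolding R_def R'_def
    by (intro fps_agree_mult fps_agree_inverse fps_qpoch_agree) (use c that in \<open>auto simp: fps_qpoch_nth_0\<close>)
  have split: "{..M} = {..<N} \<union> {N..M}" "{..<M} = {..<N} \<union> {N..<M}"
    by (auto simp: M_def)
  let ?l = "fps_qpoch c 2 (Suc M) * fps_qpoch c (c - 2) M * inverse (fps_qpoch c 1 (Suc M) * fps_qpoch c (c - 1) M)"
  let ?f = "\<lambda>n. fps_X ^ n * inverse (1 - fps_X ^ (c * n + 1)) :: rat fps"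
  let ?g = "\<lambda>n. fps_X ^ ((c - 1) * n + (c - 2)) * inverse (1 - fps_X ^ (c * n + (c - 1))) :: rat fps"
  have "fps_agree N (qres c 2 * qres c (c - 2) * inverse (qres c 1 * qres c (c - 1))) ?l"
    by (rule fps_agree_sym, intro fps_agree_mult fps_agree_inverse fps_qpoch_agree)
       (use c in \<open>auto simp: fps_qpoch_nth_0 M_def\<close>)
  also have "?l = fps_X ^ (M + 1) * 1 + (\<Sum>n\<le>M. ?f n * R (M - n) (M + n)) -
      (\<Sum>n<M. ?g n * R (Suc (M + n)) (M - Suc n))"
    unfolding R_def using lambert_fps_finite[OF c, of M] by simp
  also have "\<dots> = fps_X ^ (M + 1) * 1 +
      ((\<Sum>n<N. ?f n * R (M - n) (M + n)) + (\<Sum>n=N..M. ?f n * R (M - n) (M + n))) -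
      ((\<Sum>n<N. ?g n * R (Suc (M + n)) (M - Suc n)) + (\<Sum>n=N..<M. ?g n * R (Suc (M + n)) (M - Suc n)))"
    unfolding split by (subst (1 2) sum.union_disjoint) auto
  also have "fps_agree N \<dots> (0 + ((\<Sum>n<N. ?f n * R') + (\<Sum>n=N..M. 0)) - ((\<Sum>n<N. ?g n * R') + (\<Sum>n=N..<M. 0)))"
  proof (intro fps_agree_add fps_agree_diff fps_agree_sum)
    show "fps_agree N (fps_X ^ (M + 1) * 1) (0 :: rat fps)"
      by (rule fps_agree_X_power) (simp add: M_def)
  next
    fix n assume "n \<in> {..<N}"
    then show "fps_agree N (?f n * R (M - n) (M + n)) (?f n * R')"
      by (intro fps_agree_mult fps_agree_refl R) (auto simp: M_def)
  next
    fix n assume "n \<in> {N..M}"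
    then show "fps_agree N (?f n * R (M - n) (M + n)) 0"
      unfolding mult.assoc by (intro fps_agree_X_power) auto
  next
    fix n assume "n \<in> {..<N}"
    then show "fps_agree N (?g n * R (Suc (M + n)) (M - Suc n)) (?g n * R')"
      by (intro fps_agree_mult fps_agree_refl R) (auto simp: M_def)
  next
    fix n assume n: "n \<in> {N..<M}"
    have "n \<le> (c - 1) * n" using c by auto
    moreover have "N \<le> n" using n by simp
    ultimately have "N \<le> (c - 1) * n + (c - 2)" by linarith
    then show "fps_agree N (?g n * R (Suc (M + n)) (M - Suc n)) 0"
      unfolding mult.assoc by (rule fps_agree_X_power)
  qed
  also have "(0 + ((\<Sum>n<N. ?f n * R') + (\<Sum>n=N..M. 0)) - ((\<Sum>n<N. ?g n * R') + (\<Sum>n=N..<M. 0))) =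
      R' * ((\<Sum>n<N. ?f n) - (\<Sum>n<N. ?g n))"
    by (simp only: sum.neutral_const sum_distrib_right [symmetric]) (simp add: algebra_simps)
  also have "fps_agree N \<dots> (R' * lambert c)"
  proof (intro fps_agree_mult fps_agree_refl)
    show "fps_agree N ((\<Sum>n<N. ?f n) - (\<Sum>n<N. ?g n)) (lambert c)"
      unfolding fps_agree_def
    proof (intro allI impI)
      fix i assume i: "i < N"
      show "fps_nth ((\<Sum>n<N. ?f n) - (\<Sum>n<N. ?g n)) i = fps_nth (lambert c) i"
        by (simp only: fps_sub_nth lambert_sum_pos[OF c i] lambert_sum_neg[OF c i] lambert_def fps_nth_Abs_fps)
    qed
  qed
  finally show "fps_agree N (qres c 2 * qres c (c - 2) * inverse (qres c 1 * qres c (c - 1)))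
    (qres c 1 * qres c (c - 1) * inverse (qres c c * qres c c) * lambert c)"
    unfolding R'_def .
qed

section \<open>The 2-dissection of $E(q^3)^3/E(q)$\<close>

lemma qprod_cong:
  assumes "A - {0} = B - {0}"
  shows "qprod A = qprod B"
proof -
  have "S \<inter> {1..n} = (S - {0}) \<inter> {1..n}" for n and S :: "nat set"
    by auto
  then have "A \<inter> {1..n} = B \<inter> {1..n}" for n
    using assms by metis
  then show ?thesis by (simp add: qprod_def)
qed

lemma qprod_empty [simp]: "qprod {} = 1"
  by (rule fps_ext) (simp add: qprod_def)

lemma qprod_UN:
  assumes "finite I" "disjoint_family_on A I"
  shows "qprod (\<Union>i\<in>I. A i) = (\<Prod>i\<in>I. qprod (A i) :: 'a::comm_ring_1 fps)"
  using assms
proof (induction I rule: finite_induct)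
  case (insert i I)
  have "A i \<inter> (\<Union>j\<in>I. A j) = {}"
    using insert.prems insert.hyps by (auto simp: disjoint_family_on_def)
  moreover have "disjoint_family_on A I"
    using insert.prems by (rule disjoint_family_on_mono[rotated]) auto
  ultimately show ?case
    using insert by (simp add: qprod_Un)
qed simp

lemma qres_split:
  assumes "k > 0" "c > 0"
  shows "qres c r = (\<Prod>i<k. qres (k * c) (c * i + r))"
proof -
  have "range (\<lambda>n. c * n + r) = (\<Union>i<k. range (\<lambda>n. k * c * n + (c * i + r)))"
  proof (intro equalityI subsetI)
    fix m assume "m \<in> range (\<lambda>n. c * n + r)"
    then obtain n where "m = c * n + r" by auto
    also have "c * n = c * (k * (n div k) + n mod k)" by simp
    also have "\<dots> + r = k * c * (n div k) + (c * (n mod k) + r)"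
      by (simp only: distrib_left mult_ac add.assoc)
    finally show "m \<in> (\<Union>i<k. range (\<lambda>n. k * c * n + (c * i + r)))"
      using assms by (intro UN_I[of "n mod k"]) auto
  next
    fix m assume "m \<in> (\<Union>i<k. range (\<lambda>n. k * c * n + (c * i + r)))"
    then obtain i n where "m = k * c * n + (c * i + r)" by auto
    then have "m = c * (k * n + i) + r" by (simp add: algebra_simps)
    then show "m \<in> range (\<lambda>n. c * n + r)" by blast
  qed
  moreover have "disjoint_family_on (\<lambda>i. range (\<lambda>n. k * c * n + (c * i + r))) {..<k}"
    unfolding disjoint_family_on_def
  proof (intro ballI impI)
    fix i j assume ij: "i \<in> {..<k}" "j \<in> {..<k}" "i \<noteq> j"
    have False if "k * c * n + (c * i + r) = k * c * n' + (c * j + r)" for n n'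
    proof -
      have "c * (k * n + i) = c * (k * n' + j)"
        using that by (simp add: algebra_simps)
      then have "k * n + i = k * n' + j" using assms by simp
      then have "(k * n + i) mod k = (k * n' + j) mod k" by simp
      then show False using ij by simp
    qed
    then show "range (\<lambda>n. k * c * n + (c * i + r)) \<inter> range (\<lambda>n. k * c * n + (c * j + r)) = {}"
      by auto
  qed
  ultimately show ?thesis
    by (simp add: qres_def qprod_UN)
qed

lemma Eq_qres:
  assumes "c > 0"
  shows "Eq c = qres c c"
  unfolding Eq_qprod[OF assms] qres_def
proof (rule qprod_cong)
  have "m \<in> range (\<lambda>n. c * n + c)" if m: "c dvd m" "m \<noteq> 0" for m
  proof -
    obtain b where "m = c * b" using m by blast
    moreover from this obtain b' where "b = Suc b'" using m by (cases b) auto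
    ultimately have "m = c * b' + c" by simp
    then show ?thesis by blast
  qed
  moreover have "c dvd c * n + c" for n by simp
  ultimately show "{m. c dvd m} - {0} = range (\<lambda>n. c * n + c) - {0}"
    by blast
qed

lemma fps_mult_inverse_eq_iff:
  fixes f g d :: "'a::field fps"
  assumes "fps_nth d 0 \<noteq> 0"
  shows "f * inverse d = g \<longleftrightarrow> f = g * d"
proof -
  have "f = f * inverse d * d"
    by (simp only: mult.assoc inverse_mult_eq_1[OF assms] mult_1_right)
  moreover have "g = g * d * inverse d"
    by (simp only: mult.assoc inverse_mult_eq_1'[OF assms] mult_1_right)
  ultimately show ?thesis by metis
qed

text \<open>For c = 3 the residues 2 and c - 2 are again c - 1 and 1, so the left side of
  \<open>lambert_product\<close> collapses to 1.\<close>

lemma lambert_3: "lambert 3 * Eq 1 = Eq 3 ^ 3"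
proof -
  define a where "a = qres 3 1 * qres 3 2"
  have [simp]: "fps_nth a 0 = 1" by (simp add: a_def)
  have E1: "Eq 1 = a * Eq 3"
    using qres_split[of 3 1 1]
    by (simp add: Eq_qres a_def lessThan_nat_numeral lessThan_Suc numeral_2_eq_2 [symmetric] mult_ac)
  have "a * inverse a = a * inverse (Eq 3 * Eq 3) * lambert 3"
    using lambert_product[of 3] by (simp add: Eq_qres a_def mult.commute[of "qres 3 2"])
  also have "a * inverse a = 1"
    by (rule inverse_mult_eq_1') simp
  finally have "a * lambert 3 * inverse (Eq 3 * Eq 3) = 1"
    by (simp only: mult_ac)
  then have "a * lambert 3 = 1 * (Eq 3 * Eq 3)"
    by (subst (asm) fps_mult_inverse_eq_iff) simp_all
  then have "a * lambert 3 * Eq 3 = Eq 3 * Eq 3 * Eq 3" by simp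
  then show ?thesis unfolding E1 power3_eq_cube by (simp only: mult_ac)
qed

text \<open>Modulo 6 the classes 2 and 4 give E_2/E_6 and the class 3 gives E_3/E_6; the classes 1
  and 5 are what then remains of E_1.\<close>

lemma lambert_6: "lambert 6 * Eq 1 ^ 2 * Eq 6 = Eq 2 ^ 3 * Eq 3 ^ 2"
proof -
  define a where "a = qres 6 1 * qres 6 5"
  define b where "b = qres 6 2 * qres 6 4"
  have [simp]: "fps_nth a 0 = 1" by (simp add: a_def)
  have E1: "Eq 1 = a * b * qres 6 3 * Eq 6"
    using qres_split[of 6 1 1]
    by (simp add: Eq_qres a_def b_def lessThan_nat_numeral lessThan_Suc numeral_2_eq_2 [symmetric] mult_ac)
  have E2: "Eq 2 = b * Eq 6"
    using qres_split[of 3 2 2]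
    by (simp add: Eq_qres b_def lessThan_nat_numeral lessThan_Suc numeral_2_eq_2 [symmetric] mult_ac)
  have E3: "Eq 3 = qres 6 3 * Eq 6"
    using qres_split[of 2 3 3]
    by (simp add: Eq_qres lessThan_nat_numeral lessThan_Suc numeral_2_eq_2 [symmetric] mult_ac)
  have "b * inverse a = a * inverse (Eq 6 * Eq 6) * lambert 6"
    using lambert_product[of 6] by (simp add: Eq_qres a_def b_def)
  then have "b = a * inverse (Eq 6 * Eq 6) * lambert 6 * a"
    by (subst (asm) fps_mult_inverse_eq_iff) simp_all
  then have "a * a * lambert 6 * inverse (Eq 6 * Eq 6) = b"
    by (simp only: mult_ac)
  then have "a * a * lambert 6 = b * (Eq 6 * Eq 6)"
    by (subst (asm) fps_mult_inverse_eq_iff) simp_all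
  then have "a * a * lambert 6 * (b ^ 2 * qres 6 3 ^ 2 * Eq 6 ^ 3) =
      b * (Eq 6 * Eq 6) * (b ^ 2 * qres 6 3 ^ 2 * Eq 6 ^ 3)"
    by (rule arg_cong)
  then show ?thesis
    unfolding E1 E2 E3 power2_eq_square power3_eq_cube by (simp only: mult_ac)
qed

section \<open>Divisor sums of the character modulo 3\<close>

definition chi3 :: "nat \<Rightarrow> int" where
  "chi3 d = of_bool (d mod 3 = 1) - of_bool (d mod 3 = 2)"

definition divsum :: "nat \<Rightarrow> int" where
  "divsum N = (\<Sum>d | d dvd N. chi3 d)"

definition odd_divsum :: "nat \<Rightarrow> int" where
  "odd_divsum N = (\<Sum>d | d dvd N \<and> odd d. chi3 d)"

lemma divsum_card:
  assumes "N > 0"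
  shows "divsum N = int (card {d. d dvd N \<and> d mod 3 = 1}) - int (card {d. d dvd N \<and> d mod 3 = 2})"
  using assms by (simp add: divsum_def chi3_def sum_subtractf of_bool_def sum.If_cases Int_def)

lemma chi3_double: "chi3 (2 * d) = - chi3 d"
proof -
  have "(2 * d) mod 3 = 1 \<longleftrightarrow> d mod 3 = 2" "(2 * d) mod 3 = 2 \<longleftrightarrow> d mod 3 = 1"
    by presburger+
  then show ?thesis by (simp add: chi3_def)
qed

text \<open>Odd divisors of 2N divide N. Even ones are twice a divisor of N, and the character takes
  the value -1 at 2.\<close>

lemma divsum_double:
  assumes "N > 0"
  shows "divsum (2 * N) = odd_divsum N - divsum N"
proof -
  have "{d. d dvd 2 * N} = {d. d dvd N \<and> odd d} \<union> (*) 2 ` {d. d dvd N}"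
  proof (intro equalityI subsetI)
    fix d assume "d \<in> {d. d dvd 2 * N}"
    then have d: "d dvd 2 * N" by simp
    show "d \<in> {d. d dvd N \<and> odd d} \<union> (*) 2 ` {d. d dvd N}"
    proof (cases "even d")
      case True
      then obtain e where "d = 2 * e" by blast
      with d show ?thesis by auto
    next
      case False
      then have "coprime d 2" by simp
      with d False show ?thesis by (simp add: coprime_dvd_mult_right_iff)
    qed
  qed auto
  then have "divsum (2 * N) = sum chi3 ({d. d dvd N \<and> odd d} \<union> (*) 2 ` {d. d dvd N})"
    by (simp only: divsum_def)
  also have "\<dots> = odd_divsum N + sum chi3 ((*) 2 ` {d. d dvd N})"
    unfolding odd_divsum_def
  proof (rule sum.union_disjoint)
    show "finite {d. d dvd N \<and> odd d}"
      by (rule finite_subset[OF _ finite_divisors_nat[OF assms]]) blast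
    show "finite ((*) 2 ` {d. d dvd N})"
      by (intro finite_imageI finite_divisors_nat assms)
    show "{d. d dvd N \<and> odd d} \<inter> (*) 2 ` {d. d dvd N} = {}"
      by (intro equalityI subsetI) (auto simp only: Int_iff mem_Collect_eq image_iff dvd_triv_left)
  qed
  also have "(\<Sum>d\<in>(*) 2 ` {d. d dvd N}. chi3 d) = - divsum N"
    by (subst sum.reindex) (auto simp: inj_on_def chi3_double sum_negf divsum_def)
  finally show ?thesis by simp
qed

lemma odd_divsum_double: "odd_divsum (2 * N) = odd_divsum N"
proof -
  have "d dvd 2 * N \<and> odd d \<longleftrightarrow> d dvd N \<and> odd d" for d
    by (auto simp: coprime_dvd_mult_right_iff)
  then show ?thesis by (simp add: odd_divsum_def)
qed

lemma odd_divsum_odd: "odd N \<Longrightarrow> odd_divsum N = divsum N"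
  unfolding odd_divsum_def divsum_def
  by (rule sum.cong) (auto elim: dvdE)

text \<open>Doubling N replaces the divisor sum s by o - s, where the sum o over odd divisors stays
  fixed: an involution. For odd N one has o = s, which is why the next sum vanishes.\<close>

lemma divsum_four: "N > 0 \<Longrightarrow> divsum (4 * N) = divsum N"
  using divsum_double[of "2 * N"] divsum_double[of N] by (simp add: odd_divsum_double)

lemma divsum_double_odd: "odd N \<Longrightarrow> divsum (2 * N) = 0"
  using divsum_double[of N] by (simp add: odd_divsum_odd odd_pos)

lemma lambert_3_nth: "fps_nth (lambert 3) k = of_int (divsum (3 * k + 1))"
  by (simp add: lambert_def divsum_card)

text \<open>All divisors of 6k + 1 are odd, so their residue modulo 3 already determines the one
  modulo 6.\<close>

lemma lambert_6_nth: "fps_nth (lambert 6) k = of_int (divsum (6 * k + 1))"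
proof -
  have odd: "odd d" if "d dvd 6 * k + 1" for d
  proof
    assume "even d"
    then have "2 dvd 6 * k + 1" using that dvd_trans by blast
    then show False by presburger
  qed
  have "d mod 6 = 1 \<longleftrightarrow> d mod 3 = 1" "d mod 6 = 5 \<longleftrightarrow> d mod 3 = 2" if "odd d" for d :: nat
    using that by presburger+
  with odd have "{d. d dvd 6 * k + 1 \<and> d mod 6 = 1} = {d. d dvd 6 * k + 1 \<and> d mod 3 = 1}"
    "{d. d dvd 6 * k + 1 \<and> d mod 6 = 5} = {d. d dvd 6 * k + 1 \<and> d mod 3 = 2}"
    by blast+
  then show ?thesis
    by (simp add: lambert_def divsum_card)
qed

text \<open>The number 3k + 1 equals 6m + 1 for k = 2m, 4(3m + 1) for k = 4m + 1, and 2(6m + 5) for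
  k = 4m + 3. These are the cases of equality, invariance under the factor 4, and vanishing.\<close>

lemma lambert_3_dissection:
  "lambert 3 = (lambert 6 oo fps_X ^ 2) + fps_X * (lambert 3 oo fps_X ^ 4)"
proof (rule fps_ext)
  fix k :: nat
  let ?r = "(lambert 6 oo fps_X ^ 2) + fps_X * (lambert 3 oo fps_X ^ 4)"
  consider m where "k = 2 * m" | m where "k = 4 * m + 1" | m where "k = 4 * m + 3"
  proof -
    have "k = 2 * (k div 2) \<or> k = 4 * (k div 4) + 1 \<or> k = 4 * (k div 4) + 3" by presburger
    then show thesis using that by blast
  qed
  then show "fps_nth (lambert 3) k = fps_nth ?r k"
  proof cases
    case 1
    have "fps_nth (fps_X * (lambert 3 oo fps_X ^ 4)) k = 0"
    proof (cases m)
      case (Suc j)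
      have "\<not> 4 dvd k - 1" unfolding 1 Suc by presburger
      then show ?thesis by (simp add: fps_nth_compose_X_power)
    qed (simp add: 1)
    then show ?thesis
      by (simp add: 1 fps_nth_compose_X_power lambert_3_nth lambert_6_nth)
  next
    case 2
    have "divsum (3 * k + 1) = divsum (3 * m + 1)"
      using divsum_four[of "3 * m + 1"] by (simp add: 2 algebra_simps)
    moreover have "odd k" by (simp add: 2)
    ultimately show ?thesis
      by (simp add: 2 fps_nth_compose_X_power lambert_3_nth)
  next
    case 3
    have "divsum (3 * k + 1) = 0"
      using divsum_double_odd[of "6 * m + 5"] by (simp add: 3 algebra_simps)
    moreover have "odd k" by (simp add: 3)
    moreover have "\<not> 4 dvd k - 1" unfolding 3 by presburger
    ultimately show ?thesis
      by (simp add: fps_nth_compose_X_power lambert_3_nth)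
  qed
qed

theorem Eq_3_cubed_dissection:
  "Eq 3 ^ 3 * (Eq 2 ^ 2 * Eq 4 * Eq 12) =
    Eq 1 * (Eq 4 ^ 4 * Eq 6 ^ 2 + fps_X * Eq 2 ^ 2 * Eq 12 ^ 4)"
proof -
  have l6: "(lambert 6 oo fps_X ^ 2) * Eq 2 ^ 2 * Eq 12 = Eq 4 ^ 3 * Eq 6 ^ 2"
    using arg_cong[OF lambert_6, of "\<lambda>f. f oo fps_X ^ 2"]
    by (simp add: fps_compose_mult_distrib Eq_compose_X_power flip: fps_compose_power)
  have l3: "(lambert 3 oo fps_X ^ 4) * Eq 4 = Eq 12 ^ 3"
    using arg_cong[OF lambert_3, of "\<lambda>f. f oo fps_X ^ 4"]
    by (simp add: fps_compose_mult_distrib Eq_compose_X_power flip: fps_compose_power)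
  define L6 where "L6 = lambert 6 oo fps_X ^ 2"
  define L3 where "L3 = lambert 3 oo fps_X ^ 4"
  have "Eq 3 ^ 3 * (Eq 2 ^ 2 * Eq 4 * Eq 12) = (L6 + fps_X * L3) * Eq 1 * (Eq 2 ^ 2 * Eq 4 * Eq 12)"
    by (simp only: lambert_3 [symmetric] lambert_3_dissection [folded L6_def L3_def])
  also have "\<dots> = Eq 1 * (Eq 4 * (L6 * Eq 2 ^ 2 * Eq 12) + fps_X * Eq 2 ^ 2 * Eq 12 * (L3 * Eq 4))"
    by (simp only: algebra_simps)
  also have "\<dots> = Eq 1 * (Eq 4 * (Eq 4 ^ 3 * Eq 6 ^ 2) + fps_X * Eq 2 ^ 2 * Eq 12 * Eq 12 ^ 3)"
    by (simp only: l6 [folded L6_def] l3 [folded L3_def])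
  also have "\<dots> = Eq 1 * (Eq 4 ^ 4 * Eq 6 ^ 2 + fps_X * Eq 2 ^ 2 * Eq 12 ^ 4)"
    by (simp only: power2_eq_square power3_eq_cube power4_eq_xxxx algebra_simps)
  finally show ?thesis .
qed

section \<open>Monomial identities between eta quotients\<close>

text \<open>In these lemmas \<open>e1\<close>, \<open>e2\<close>, ... stand for E_1, E_2, ... as
  independent nonzero field elements. The quotients e2^3/(e1 e4) and e6^3/(e3 e12) are E_1 and E_3
  at -q, and v stands for 1 - h.\<close>

lemma field_one_minus:
  fixes e1 :: "'a::field"
  assumes nz: "e1 \<noteq> 0" "e2 \<noteq> 0" "e3 \<noteq> 0" "e4 \<noteq> 0" "e6 \<noteq> 0" "e12 \<noteq> 0"
    and "v * ((e2 ^ 3 / (e1 * e4)) * e4 ^ 3 * e6 ^ 2) = (e6 ^ 3 / (e3 * e12)) ^ 3 * e2 ^ 2 * e12"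
  shows "v = e1 * e6 ^ 7 / (e2 * e3 ^ 3 * e4 ^ 2 * e12 ^ 2)"
proof -
  have "v = (e6 ^ 3 / (e3 * e12)) ^ 3 * e2 ^ 2 * e12 / ((e2 ^ 3 / (e1 * e4)) * e4 ^ 3 * e6 ^ 2)"
    by (rule eq_divide_imp[OF _ assms(7)]) (use nz in simp)
  also have "\<dots> = e1 * e6 ^ 7 / (e2 * e3 ^ 3 * e4 ^ 2 * e12 ^ 2)"
    using nz by (simp add: field_simps eval_nat_numeral)
  finally show ?thesis .
qed

lemma field_product:
  fixes e1 :: "'a::field"
  assumes nz: "e1 \<noteq> 0" "e2 \<noteq> 0" "e3 \<noteq> 0" "e4 \<noteq> 0" "e6 \<noteq> 0" "e12 \<noteq> 0"
  shows "e3 ^ 3 * e2 ^ 2 * e12 / (e1 * e4 ^ 3 * e6 ^ 2) * (e1 * e6 ^ 7 / (e2 * e3 ^ 3 * e4 ^ 2 * e12 ^ 2))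
     = e2 * e6 ^ 5 / (e4 ^ 5 * e12)"
    using nz by (simp add: field_simps eval_nat_numeral)

text \<open>Here $H$ is $h(q^2)$. The two products $h^2 X = H(1-H)$ and $(1-h^2) X = (1+H)^2$ add up to a formula
for $X$: this is how the factor $1 + 3h$ arises from $1 \pm h$ alone.\<close>
lemma field_level_raising:
  fixes e2 :: "'a::field"
  assumes nz: "e2 \<noteq> 0" "e4 \<noteq> 0" "e6 \<noteq> 0" "e8 \<noteq> 0" "e12 \<noteq> 0" "e24 \<noteq> 0"
    and h: "h = x * e2 ^ 2 * e12 ^ 4 / (e4 ^ 4 * e6 ^ 2)"
    and hh: "1 - h ^ 2 = e2 * e6 ^ 5 / (e4 ^ 5 * e12)"
    and H: "H = x ^ 2 * e4 ^ 2 * e24 ^ 4 / (e8 ^ 4 * e12 ^ 2)"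
    and H1: "1 - H = e2 * e12 ^ 7 / (e4 * e6 ^ 3 * e8 ^ 2 * e24 ^ 2)"
    and H2: "1 + H = e6 ^ 3 * e4 ^ 2 * e24 / (e2 * e8 ^ 3 * e12 ^ 2)"
  defines "X \<equiv> e6 * e4 ^ 9 * e24 ^ 2 / (e2 ^ 3 * e8 ^ 6 * e12 ^ 3)"
  shows "X = 1 + 3 * H"
proof -
  have "h ^ 2 * X = H * (e2 * e12 ^ 7 / (e4 * e6 ^ 3 * e8 ^ 2 * e24 ^ 2))"
    unfolding h H X_def using nz by (simp add: field_simps eval_nat_numeral)
  then have "h ^ 2 * X = H * (1 - H)" by (simp only: H1)
  moreover have "e2 * e6 ^ 5 / (e4 ^ 5 * e12) * X = (e6 ^ 3 * e4 ^ 2 * e24 / (e2 * e8 ^ 3 * e12 ^ 2)) ^ 2"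
    unfolding X_def using nz by (simp add: field_simps eval_nat_numeral)
  then have "(1 - h ^ 2) * X = (1 + H) ^ 2" by (simp only: hh H2)
  moreover have "X = h ^ 2 * X + (1 - h ^ 2) * X" by (simp add: algebra_simps)
  ultimately have "X = H * (1 - H) + (1 + H) ^ 2" by (simp only:)
  then show ?thesis by (simp add: algebra_simps power2_eq_square)
qed

lemma field_one_minus_3:
  fixes e1 :: "'a::field"
  assumes nz: "e1 \<noteq> 0" "e2 \<noteq> 0" "e3 \<noteq> 0" "e4 \<noteq> 0" "e6 \<noteq> 0" "e12 \<noteq> 0"
    and "v * ((e2 ^ 3 / (e1 * e4)) ^ 3 * e4 ^ 6 * e6 ^ 3) = (e6 ^ 3 / (e3 * e12)) * e2 ^ 9 * e12 ^ 2"
  shows "v = e12 * e1 ^ 3 / (e4 ^ 3 * e3)"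
proof -
  have "v = (e6 ^ 3 / (e3 * e12)) * e2 ^ 9 * e12 ^ 2 / ((e2 ^ 3 / (e1 * e4)) ^ 3 * e4 ^ 6 * e6 ^ 3)"
    by (rule eq_divide_imp[OF _ assms(7)]) (use nz in simp)
  also have "\<dots> = e12 * e1 ^ 3 / (e4 ^ 3 * e3)"
    using nz by (simp add: field_simps eval_nat_numeral)
  finally show ?thesis .
qed

lemma field_xi:
  fixes e1 :: "'a::field"
  assumes nz: "e1 \<noteq> 0" "e2 \<noteq> 0" "e3 \<noteq> 0" "e4 \<noteq> 0" "e6 \<noteq> 0" "e12 \<noteq> 0"
  shows "e2 ^ 5 * e6 / (e1 * e3 ^ 5) * (e3 ^ 3 * e2 ^ 2 * e12 / (e1 * e4 ^ 3 * e6 ^ 2)) ^ 2 =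
    e3 * e2 ^ 9 * e12 ^ 2 / (e1 ^ 3 * e4 ^ 6 * e6 ^ 3)"
  using nz by (simp add: field_simps eval_nat_numeral)

lemma field_gamma:
  fixes e1 :: "'a::field"
  assumes nz: "e1 \<noteq> 0" "e2 \<noteq> 0" "e3 \<noteq> 0" "e4 \<noteq> 0" "e6 \<noteq> 0" "e12 \<noteq> 0"
  shows "(e2 ^ 5 * e4 ^ 5 * e12 ^ 5 / e6 ^ 15) ^ 2 * (e1 * e6 ^ 7 / (e2 * e3 ^ 3 * e4 ^ 2 * e12 ^ 2)) ^ 5 =
    e1 ^ 5 * e2 ^ 5 * e6 ^ 5 / e3 ^ 15"
proof -
  \<comment> \<open>Everything is a fifth power; comparing the fifth roots keeps the exponents
    small.\<close>
  let ?y = "e2 * e4 * e12 / e6 ^ 3" and ?z = "e1 * e6 ^ 7 / (e2 * e3 ^ 3 * e4 ^ 2 * e12 ^ 2)"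
  have "e2 ^ 5 * e4 ^ 5 * e12 ^ 5 / e6 ^ 15 = ?y ^ 5" "e1 ^ 5 * e2 ^ 5 * e6 ^ 5 / e3 ^ 15 = (e1 * e2 * e6 / e3 ^ 3) ^ 5"
    by (simp_all add: power_mult_distrib power_divide flip: power_mult)
  moreover have "(y ^ 5) ^ 2 * z ^ 5 = (y ^ 2 * z) ^ 5" for y z :: 'a
    by (simp add: power_mult_distrib flip: power_mult)
  moreover have "?y ^ 2 * ?z = e1 * e2 * e6 / e3 ^ 3"
    using nz by (simp add: field_simps eval_nat_numeral)
  ultimately show ?thesis by (simp only:)
qed

text \<open>With s(1 - h^2) = 1 the expression becomes s(1 - 9h^2), whose two linear factors in h
  are known eta quotients. Here s is xi at q^2.\<close>

lemma field_nine_minus_8_xi: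
  fixes e2 :: "'a::field"
  assumes nz: "e2 \<noteq> 0" "e4 \<noteq> 0" "e6 \<noteq> 0" "e12 \<noteq> 0"
    and "s = e4 ^ 5 * e12 / (e2 * e6 ^ 5)" "s * (1 - h ^ 2) = 1"
    and u: "1 + 3 * h = e3 * e2 ^ 9 * e12 ^ 2 / (e1 ^ 3 * e4 ^ 6 * e6 ^ 3)"
    and v: "1 - 3 * h = e12 * e1 ^ 3 / (e4 ^ 3 * e3)"
    and nz': "e1 \<noteq> 0" "e3 \<noteq> 0"
  shows "9 - 8 * s = e2 ^ 8 * e12 ^ 4 / (e4 ^ 4 * e6 ^ 8)"
proof -
  have "9 - 8 * s = 9 * (s * (1 - h ^ 2)) - 8 * s"
    using assms(6) by simp
  also have "\<dots> = s * ((1 + 3 * h) * (1 - 3 * h))"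
    by (simp add: algebra_simps power2_eq_square)
  also have "\<dots> = e2 ^ 8 * e12 ^ 4 / (e4 ^ 4 * e6 ^ 8)"
    unfolding u v assms(5) using nz nz' by (simp add: field_simps eval_nat_numeral)
  finally show ?thesis .
qed

lemma field_gamma_6:
  fixes e1 :: "'a::field"
  assumes nz: "e1 \<noteq> 0" "e2 \<noteq> 0" "e3 \<noteq> 0" "e6 \<noteq> 0"
  shows "(e1 ^ 5 * e2 ^ 5 * e6 ^ 5 / e3 ^ 15) ^ 6 =
    (e2 ^ 5 * e6 / (e1 * e3 ^ 5)) ^ 10 * (e1 ^ 8 * e6 ^ 4 / (e2 ^ 4 * e3 ^ 8)) ^ 5"
proof -
  \<comment> \<open>Again the identity is checked before taking fifth powers.\<close>
  have "(e1 * e2 * e6 / e3 ^ 3) ^ 6 = (e2 ^ 5 * e6 / (e1 * e3 ^ 5)) ^ 2 * (e1 ^ 8 * e6 ^ 4 / (e2 ^ 4 * e3 ^ 8))"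
    using nz by (simp add: field_simps eval_nat_numeral)
  then have "((e1 * e2 * e6 / e3 ^ 3) ^ 6) ^ 5 =
      ((e2 ^ 5 * e6 / (e1 * e3 ^ 5)) ^ 2 * (e1 ^ 8 * e6 ^ 4 / (e2 ^ 4 * e3 ^ 8))) ^ 5"
    by (rule arg_cong)
  then show ?thesis
    by (simp add: power_mult_distrib power_divide flip: power_mult)
qed

text \<open>The squares of P_0(q) and P_0(-q) share the factor T = E_4^5 E_6^5/(E_2^7 E_12^3), which
  is even in q. The remaining quotients are (1 + 3h)/(1 + h) and (1 - 3h)/(1 - h).\<close>

lemma field_PDO_square:
  fixes e1 :: "'a::field"
  assumes nz: "e1 \<noteq> 0" "e2 \<noteq> 0" "e3 \<noteq> 0" "e4 \<noteq> 0" "e6 \<noteq> 0" "e12 \<noteq> 0"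
  shows "(e4 * e6 ^ 2 / (e1 * e3 * e12)) ^ 2 = e4 ^ 5 * e6 ^ 5 / (e2 ^ 7 * e12 ^ 3) *
    ((e3 * e2 ^ 9 * e12 ^ 2 / (e1 ^ 3 * e4 ^ 6 * e6 ^ 3)) / (e3 ^ 3 * e2 ^ 2 * e12 / (e1 * e4 ^ 3 * e6 ^ 2)))"
  and "(e1 * e3 * e4 ^ 2 / (e2 ^ 3 * e6)) ^ 2 = e4 ^ 5 * e6 ^ 5 / (e2 ^ 7 * e12 ^ 3) *
    ((e12 * e1 ^ 3 / (e4 ^ 3 * e3)) / (e1 * e6 ^ 7 / (e2 * e3 ^ 3 * e4 ^ 2 * e12 ^ 2)))"
  using nz by (simp_all add: field_simps eval_nat_numeral)

text \<open>With H = h(q^2) and the same T: the product P_0(q) P_0(-q) is T(1 - 3H)/(1 + H), and T(1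
  - H)/(1 + H)^2 is the fourth power of P_0(q^2).\<close>

lemma field_PDO_mult:
  fixes e1 :: "'a::field"
  assumes nz: "e1 \<noteq> 0" "e2 \<noteq> 0" "e3 \<noteq> 0" "e4 \<noteq> 0" "e6 \<noteq> 0" "e8 \<noteq> 0" "e12 \<noteq> 0" "e24 \<noteq> 0"
  shows "e4 * e6 ^ 2 / (e1 * e3 * e12) * (e1 * e3 * e4 ^ 2 / (e2 ^ 3 * e6)) =
    e4 ^ 5 * e6 ^ 5 / (e2 ^ 7 * e12 ^ 3) *
    ((e24 * e2 ^ 3 / (e8 ^ 3 * e6)) / (e6 ^ 3 * e4 ^ 2 * e24 / (e2 * e8 ^ 3 * e12 ^ 2)))"
  and "e4 ^ 5 * e6 ^ 5 / (e2 ^ 7 * e12 ^ 3) *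
      ((e2 * e12 ^ 7 / (e4 * e6 ^ 3 * e8 ^ 2 * e24 ^ 2)) / (e6 ^ 3 * e4 ^ 2 * e24 / (e2 * e8 ^ 3 * e12 ^ 2)) ^ 2) =
    (e8 ^ 2 * e12 ^ 4 / (e2 ^ 2 * e6 ^ 2 * e24 ^ 2)) ^ 2"
  using nz by (simp_all add: field_simps eval_nat_numeral)

text \<open>That is, gamma(q^2) T = xi(q^2)^2: multiplication by gamma removes the factor T.\<close>

lemma field_gamma_T:
  fixes e2 :: "'a::field"
  assumes nz: "e2 \<noteq> 0" "e4 \<noteq> 0" "e6 \<noteq> 0" "e12 \<noteq> 0"
  shows "e2 ^ 5 * e4 ^ 5 * e12 ^ 5 / e6 ^ 15 * (e4 ^ 5 * e6 ^ 5 / (e2 ^ 7 * e12 ^ 3)) = (e4 ^ 5 * e12 / (e2 * e6 ^ 5)) ^ 2"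
  using nz by (simp add: field_simps eval_nat_numeral)

section \<open>The dissection parameter\<close>

abbreviation "fls_Eq a \<equiv> fps_to_fls (Eq a)"

lemmas fps_to_fls_hom = fls_times_fps_to_fls fps_to_fls_power fps_to_fls_inverse

lemma fps_to_fls_eqD: "f = g \<Longrightarrow> fps_to_fls f = fps_to_fls g" by simp

text \<open>The series h: X times a series in X^2, because every E_n that occurs has even n.\<close>

definition dissect :: "rat fps" where
  "dissect = fps_X * Eq 2 ^ 2 * Eq 12 ^ 4 * inverse (Eq 4 ^ 4 * Eq 6 ^ 2)"

lemma dissect_mult: "dissect * (Eq 4 ^ 4 * Eq 6 ^ 2) = fps_X * Eq 2 ^ 2 * Eq 12 ^ 4"
  using fps_mult_inverse_eq_iff[of "Eq 4 ^ 4 * Eq 6 ^ 2" _ dissect] by (simp add: dissect_def)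

lemma dissect_fls:
  "fps_to_fls dissect = fls_X * fls_Eq 2 ^ 2 * fls_Eq 12 ^ 4 / (fls_Eq 4 ^ 4 * fls_Eq 6 ^ 2)"
  using fps_to_fls_eqD[OF dissect_mult] by (simp add: fps_to_fls_hom eq_divide_eq)

text \<open>Oddness turns each identity for 1 + h or 1 + 3h into one for 1 - h or 1 - 3h.\<close>

lemma dissect_compose_uminus: "dissect oo (- fps_X) = - dissect"
proof -
  have "(dissect oo (- fps_X)) * (Eq 4 ^ 4 * Eq 6 ^ 2) = - fps_X * Eq 2 ^ 2 * Eq 12 ^ 4"
    using arg_cong[OF dissect_mult, of "\<lambda>f. f oo - fps_X"]
      Eq_even_compose_uminus[of 1] Eq_even_compose_uminus[of 2] Eq_even_compose_uminus[of 3]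
      Eq_even_compose_uminus[of 6]
    by (simp add: fps_compose_mult_distrib flip: fps_compose_power)
  also have "\<dots> = - dissect * (Eq 4 ^ 4 * Eq 6 ^ 2)"
    using dissect_mult by simp
  finally show ?thesis by (subst (asm) mult_right_cancel) simp_all
qed

lemma one_plus_dissect: "(1 + dissect) * (Eq 1 * Eq 4 ^ 3 * Eq 6 ^ 2) = Eq 3 ^ 3 * Eq 2 ^ 2 * Eq 12"
proof -
  have "Eq 4 * ((1 + dissect) * (Eq 1 * Eq 4 ^ 3 * Eq 6 ^ 2)) =
      Eq 1 * (Eq 4 ^ 4 * Eq 6 ^ 2 + dissect * (Eq 4 ^ 4 * Eq 6 ^ 2))"
    by (simp add: power_numeral_reduce algebra_simps)
  also have "\<dots> = Eq 4 * (Eq 3 ^ 3 * Eq 2 ^ 2 * Eq 12)"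
    unfolding dissect_mult Eq_3_cubed_dissection [symmetric] by (simp only: mult_ac)
  finally show ?thesis by simp
qed

lemma fls_Eq_odd_compose_uminus:
  assumes "odd a"
  shows "fps_to_fls (Eq a oo (- fps_X)) = fls_Eq (2 * a) ^ 3 / (fls_Eq a * fls_Eq (4 * a))"
  using fps_to_fls_eqD[OF Eq_odd_compose_uminus[OF assms]]
  by (simp add: fps_to_fls_hom eq_divide_eq mult.assoc)

lemma one_plus_dissect_fls:
  "1 + fps_to_fls dissect = fls_Eq 3 ^ 3 * fls_Eq 2 ^ 2 * fls_Eq 12 / (fls_Eq 1 * fls_Eq 4 ^ 3 * fls_Eq 6 ^ 2)"
  using fps_to_fls_eqD[OF one_plus_dissect] by (simp add: fps_to_fls_hom eq_divide_eq)

lemma Eq_even_compose_uminus':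
  "even a \<Longrightarrow> a > 0 \<Longrightarrow> Eq a oo (- fps_X) = Eq a"
  by (elim evenE) (simp add: Eq_even_compose_uminus)

lemmas compose_uminus_simps = fps_compose_mult_distrib fps_compose_add_distrib fps_compose_sub_distrib
  Eq_even_compose_uminus' dissect_compose_uminus fps_compose_power [symmetric]

lemma one_minus_dissect_fls:
  "1 - fps_to_fls dissect = fls_Eq 1 * fls_Eq 6 ^ 7 / (fls_Eq 2 * fls_Eq 3 ^ 3 * fls_Eq 4 ^ 2 * fls_Eq 12 ^ 2)"
proof -
  have "(1 - dissect) * ((Eq 1 oo (- fps_X)) * Eq 4 ^ 3 * Eq 6 ^ 2) = (Eq 3 oo (- fps_X)) ^ 3 * Eq 2 ^ 2 * Eq 12"
    using arg_cong[OF one_plus_dissect, of "\<lambda>f. f oo - fps_X"]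
    by (simp add: compose_uminus_simps)
  from fps_to_fls_eqD[OF this] show ?thesis
    by (intro field_one_minus) (simp_all add: fps_to_fls_hom fls_Eq_odd_compose_uminus)
qed

lemma one_minus_dissect_square_fls:
  "1 - fps_to_fls dissect ^ 2 = fls_Eq 2 * fls_Eq 6 ^ 5 / (fls_Eq 4 ^ 5 * fls_Eq 12)"
proof -
  have "1 - fps_to_fls dissect ^ 2 = (1 + fps_to_fls dissect) * (1 - fps_to_fls dissect)"
    by (simp add: algebra_simps power2_eq_square)
  also have "\<dots> = fls_Eq 2 * fls_Eq 6 ^ 5 / (fls_Eq 4 ^ 5 * fls_Eq 12)"
    unfolding one_plus_dissect_fls one_minus_dissect_fls by (rule field_product) simp_all
  finally show ?thesis .
qed

lemmas compose_square_simps = fps_compose_mult_distrib fps_compose_add_distrib fps_compose_sub_distrib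
  Eq_compose_X_power fps_compose_power [symmetric]

lemma dissect_compose_fls:
  "fps_to_fls (dissect oo fps_X ^ 2) = fls_X ^ 2 * fls_Eq 4 ^ 2 * fls_Eq 24 ^ 4 / (fls_Eq 8 ^ 4 * fls_Eq 12 ^ 2)"
proof -
  have "(dissect oo fps_X ^ 2) * (Eq 8 ^ 4 * Eq 12 ^ 2) = fps_X ^ 2 * Eq 4 ^ 2 * Eq 24 ^ 4"
    using arg_cong[OF dissect_mult, of "\<lambda>f. f oo fps_X ^ 2"] by (simp add: compose_square_simps)
  from fps_to_fls_eqD[OF this] show ?thesis by (simp add: fps_to_fls_hom eq_divide_eq)
qed

lemma one_plus_dissect_compose_fls:
  "1 + fps_to_fls (dissect oo fps_X ^ 2) =
     fls_Eq 6 ^ 3 * fls_Eq 4 ^ 2 * fls_Eq 24 / (fls_Eq 2 * fls_Eq 8 ^ 3 * fls_Eq 12 ^ 2)"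
proof -
  have "(1 + (dissect oo fps_X ^ 2)) * (Eq 2 * Eq 8 ^ 3 * Eq 12 ^ 2) = Eq 6 ^ 3 * Eq 4 ^ 2 * Eq 24"
    using arg_cong[OF one_plus_dissect, of "\<lambda>f. f oo fps_X ^ 2"] by (simp add: compose_square_simps)
  from fps_to_fls_eqD[OF this] show ?thesis by (simp add: fps_to_fls_hom eq_divide_eq)
qed

lemma one_minus_dissect:
  "(1 - dissect) * (Eq 2 * Eq 3 ^ 3 * Eq 4 ^ 2 * Eq 12 ^ 2) = Eq 1 * Eq 6 ^ 7"
proof -
  have "fps_to_fls ((1 - dissect) * (Eq 2 * Eq 3 ^ 3 * Eq 4 ^ 2 * Eq 12 ^ 2)) = fps_to_fls (Eq 1 * Eq 6 ^ 7)"
    using one_minus_dissect_fls by (simp add: fps_to_fls_hom)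
  then show ?thesis by (simp only: fps_to_fls_eq_iff)
qed

lemma one_minus_dissect_compose_fls:
  "1 - fps_to_fls (dissect oo fps_X ^ 2) =
     fls_Eq 2 * fls_Eq 12 ^ 7 / (fls_Eq 4 * fls_Eq 6 ^ 3 * fls_Eq 8 ^ 2 * fls_Eq 24 ^ 2)"
proof -
  have "(1 - (dissect oo fps_X ^ 2)) * (Eq 4 * Eq 6 ^ 3 * Eq 8 ^ 2 * Eq 24 ^ 2) = Eq 2 * Eq 12 ^ 7"
    using arg_cong[OF one_minus_dissect, of "\<lambda>f. f oo fps_X ^ 2"] by (simp add: compose_square_simps)
  from fps_to_fls_eqD[OF this] show ?thesis by (simp add: fps_to_fls_hom eq_divide_eq)
qed

text \<open>This is how identities proved at q^2 descend to q.\<close>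

lemma fps_compose_X_power_inject:
  fixes f g :: "'a::comm_ring_1 fps"
  assumes "k > 0"
  shows "f oo fps_X ^ k = g oo fps_X ^ k \<longleftrightarrow> f = g"
proof
  assume eq: "f oo fps_X ^ k = g oo fps_X ^ k"
  show "f = g"
  proof (rule fps_ext)
    fix n
    show "fps_nth f n = fps_nth g n"
      using arg_cong[OF eq, of "\<lambda>f. fps_nth f (k * n)"] assms
      by (simp add: fps_nth_compose_X_power)
  qed
qed simp

text \<open>Proved at q^2, where two products involving h(q)^2 and h(q^2) can be added; see
  \<open>field_level_raising\<close>.\<close>

lemma one_plus_3_dissect:
  "(1 + 3 * dissect) * (Eq 1 ^ 3 * Eq 4 ^ 6 * Eq 6 ^ 3) = Eq 3 * Eq 2 ^ 9 * Eq 12 ^ 2"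
proof -
  have "fls_Eq 6 * fls_Eq 4 ^ 9 * fls_Eq 24 ^ 2 / (fls_Eq 2 ^ 3 * fls_Eq 8 ^ 6 * fls_Eq 12 ^ 3) =
      1 + 3 * fps_to_fls (dissect oo fps_X ^ 2)"
    by (rule field_level_raising[OF _ _ _ _ _ _ dissect_fls one_minus_dissect_square_fls
          dissect_compose_fls one_minus_dissect_compose_fls one_plus_dissect_compose_fls]) simp_all
  then have "fps_to_fls ((1 + 3 * (dissect oo fps_X ^ 2)) * (Eq 2 ^ 3 * Eq 8 ^ 6 * Eq 12 ^ 3)) =
      fps_to_fls (Eq 6 * Eq 4 ^ 9 * Eq 24 ^ 2)"
    by (simp add: fps_to_fls_hom divide_eq_eq)
  then have "(1 + 3 * (dissect oo fps_X ^ 2)) * (Eq 2 ^ 3 * Eq 8 ^ 6 * Eq 12 ^ 3) = Eq 6 * Eq 4 ^ 9 * Eq 24 ^ 2"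
    by (simp only: fps_to_fls_eq_iff)
  then have "((1 + 3 * dissect) * (Eq 1 ^ 3 * Eq 4 ^ 6 * Eq 6 ^ 3)) oo fps_X ^ 2 =
      (Eq 3 * Eq 2 ^ 9 * Eq 12 ^ 2) oo fps_X ^ 2"
    by (simp add: compose_square_simps)
  then show ?thesis by (simp only: fps_compose_X_power_inject zero_less_numeral)
qed

lemma one_plus_3_dissect_fls:
  "1 + 3 * fps_to_fls dissect =
     fls_Eq 3 * fls_Eq 2 ^ 9 * fls_Eq 12 ^ 2 / (fls_Eq 1 ^ 3 * fls_Eq 4 ^ 6 * fls_Eq 6 ^ 3)"
  using fps_to_fls_eqD[OF one_plus_3_dissect] by (simp add: fps_to_fls_hom eq_divide_eq)

lemma one_minus_3_dissect_fls:
  "1 - 3 * fps_to_fls dissect = fls_Eq 12 * fls_Eq 1 ^ 3 / (fls_Eq 4 ^ 3 * fls_Eq 3)"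
proof -
  have "(1 - 3 * dissect) * ((Eq 1 oo (- fps_X)) ^ 3 * Eq 4 ^ 6 * Eq 6 ^ 3) = (Eq 3 oo (- fps_X)) * Eq 2 ^ 9 * Eq 12 ^ 2"
    using arg_cong[OF one_plus_3_dissect, of "\<lambda>f. f oo - fps_X"]
    by (simp add: compose_uminus_simps)
  from fps_to_fls_eqD[OF this] show ?thesis
    by (intro field_one_minus_3) (simp_all add: fps_to_fls_hom fls_Eq_odd_compose_uminus)
qed

lemma one_minus_3_dissect: "(1 - 3 * dissect) * (Eq 4 ^ 3 * Eq 3) = Eq 12 * Eq 1 ^ 3"
proof -
  have "fps_to_fls ((1 - 3 * dissect) * (Eq 4 ^ 3 * Eq 3)) = fps_to_fls (Eq 12 * Eq 1 ^ 3)"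
    using one_minus_3_dissect_fls by (simp add: fps_to_fls_hom)
  then show ?thesis by (simp only: fps_to_fls_eq_iff)
qed

lemma one_minus_3_dissect_compose_fls:
  "1 - 3 * fps_to_fls (dissect oo fps_X ^ 2) = fls_Eq 24 * fls_Eq 2 ^ 3 / (fls_Eq 8 ^ 3 * fls_Eq 6)"
proof -
  have "(1 - 3 * (dissect oo fps_X ^ 2)) * (Eq 8 ^ 3 * Eq 6) = Eq 24 * Eq 2 ^ 3"
    using arg_cong[OF one_minus_3_dissect, of "\<lambda>f. f oo fps_X ^ 2"] by (simp add: compose_square_simps)
  from fps_to_fls_eqD[OF this] show ?thesis by (simp add: fps_to_fls_hom eq_divide_eq)
qed

section \<open>xi and gamma in terms of h\<close>

lemma xi_mult: "xi_fps * (Eq 1 * Eq 3 ^ 5) = Eq 2 ^ 5 * Eq 6"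
  using fps_mult_inverse_eq_iff[of "Eq 1 * Eq 3 ^ 5" _ xi_fps] by (simp add: xi_fps_def)

lemma gamma_mult: "gamma_fps * Eq 3 ^ 15 = Eq 1 ^ 5 * Eq 2 ^ 5 * Eq 6 ^ 5"
  using fps_mult_inverse_eq_iff[of "Eq 3 ^ 15" _ gamma_fps] by (simp add: gamma_fps_def)

lemma xi_fls: "fps_to_fls xi_fps = fls_Eq 2 ^ 5 * fls_Eq 6 / (fls_Eq 1 * fls_Eq 3 ^ 5)"
  using fps_to_fls_eqD[OF xi_mult] by (simp add: fps_to_fls_hom eq_divide_eq)

lemma gamma_fls: "fps_to_fls gamma_fps = fls_Eq 1 ^ 5 * fls_Eq 2 ^ 5 * fls_Eq 6 ^ 5 / fls_Eq 3 ^ 15"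
  using fps_to_fls_eqD[OF gamma_mult] by (simp add: fps_to_fls_hom eq_divide_eq)

lemma xi_compose_fls:
  "fps_to_fls (xi_fps oo fps_X ^ 2) = fls_Eq 4 ^ 5 * fls_Eq 12 / (fls_Eq 2 * fls_Eq 6 ^ 5)"
proof -
  have "(xi_fps oo fps_X ^ 2) * (Eq 2 * Eq 6 ^ 5) = Eq 4 ^ 5 * Eq 12"
    using arg_cong[OF xi_mult, of "\<lambda>f. f oo fps_X ^ 2"] by (simp add: compose_square_simps)
  from fps_to_fls_eqD[OF this] show ?thesis by (simp add: fps_to_fls_hom eq_divide_eq)
qed

lemma gamma_compose_fls:
  "fps_to_fls (gamma_fps oo fps_X ^ 2) = fls_Eq 2 ^ 5 * fls_Eq 4 ^ 5 * fls_Eq 12 ^ 5 / fls_Eq 6 ^ 15"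
proof -
  have "(gamma_fps oo fps_X ^ 2) * Eq 6 ^ 15 = Eq 2 ^ 5 * Eq 4 ^ 5 * Eq 12 ^ 5"
    using arg_cong[OF gamma_mult, of "\<lambda>f. f oo fps_X ^ 2"] by (simp add: compose_square_simps)
  from fps_to_fls_eqD[OF this] show ?thesis by (simp add: fps_to_fls_hom eq_divide_eq)
qed

lemma xi_dissect: "xi_fps * (1 + dissect) ^ 2 = 1 + 3 * dissect"
proof -
  have "fps_to_fls xi_fps * (1 + fps_to_fls dissect) ^ 2 = 1 + 3 * fps_to_fls dissect"
    unfolding xi_fls one_plus_dissect_fls one_plus_3_dissect_fls by (rule field_xi) simp_all
  then have "fps_to_fls (xi_fps * (1 + dissect) ^ 2) = fps_to_fls (1 + 3 * dissect)"
    by (simp add: fps_to_fls_hom)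
  then show ?thesis by (simp only: fps_to_fls_eq_iff)
qed

lemma xi_compose_dissect: "(xi_fps oo fps_X ^ 2) * (1 - dissect ^ 2) = 1"
proof -
  have "fps_to_fls (xi_fps oo fps_X ^ 2) * (1 - fps_to_fls dissect ^ 2) = 1"
    unfolding xi_compose_fls one_minus_dissect_square_fls by simp
  then have "fps_to_fls ((xi_fps oo fps_X ^ 2) * (1 - dissect ^ 2)) = fps_to_fls 1"
    by (simp add: fps_to_fls_hom)
  then show ?thesis by (simp only: fps_to_fls_eq_iff)
qed

lemma gamma_dissect: "(gamma_fps oo fps_X ^ 2) ^ 2 * (1 - dissect) ^ 5 = gamma_fps"
proof -
  have "fps_to_fls (gamma_fps oo fps_X ^ 2) ^ 2 * (1 - fps_to_fls dissect) ^ 5 = fps_to_fls gamma_fps"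
    unfolding gamma_compose_fls gamma_fls one_minus_dissect_fls by (rule field_gamma) simp_all
  then have "fps_to_fls ((gamma_fps oo fps_X ^ 2) ^ 2 * (1 - dissect) ^ 5) = fps_to_fls gamma_fps"
    by (simp add: fps_to_fls_hom)
  then show ?thesis by (simp only: fps_to_fls_eq_iff)
qed

text \<open>At q^2 the factorisation over h is available, since xi(q^2) is the reciprocal of 1 -
  h^2.\<close>

lemma nine_minus_8_xi: "(9 - 8 * xi_fps) * (Eq 2 ^ 4 * Eq 3 ^ 8) = Eq 1 ^ 8 * Eq 6 ^ 4"
proof -
  have "fps_to_fls (xi_fps oo fps_X ^ 2) * (1 - fps_to_fls dissect ^ 2) = 1"
    unfolding xi_compose_fls one_minus_dissect_square_fls by simp
  then have "9 - 8 * fps_to_fls (xi_fps oo fps_X ^ 2) =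
      fls_Eq 2 ^ 8 * fls_Eq 12 ^ 4 / (fls_Eq 4 ^ 4 * fls_Eq 6 ^ 8)"
    by (intro field_nine_minus_8_xi[OF _ _ _ _ xi_compose_fls _ one_plus_3_dissect_fls one_minus_3_dissect_fls])
       simp_all
  then have "fps_to_fls ((9 - 8 * (xi_fps oo fps_X ^ 2)) * (Eq 4 ^ 4 * Eq 6 ^ 8)) = fps_to_fls (Eq 2 ^ 8 * Eq 12 ^ 4)"
    by (simp add: fps_to_fls_hom)
  then have "(9 - 8 * (xi_fps oo fps_X ^ 2)) * (Eq 4 ^ 4 * Eq 6 ^ 8) = Eq 2 ^ 8 * Eq 12 ^ 4"
    by (simp only: fps_to_fls_eq_iff)
  then have "((9 - 8 * xi_fps) * (Eq 2 ^ 4 * Eq 3 ^ 8)) oo fps_X ^ 2 = (Eq 1 ^ 8 * Eq 6 ^ 4) oo fps_X ^ 2"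
    by (simp add: compose_square_simps)
  then show ?thesis by (simp only: fps_compose_X_power_inject zero_less_numeral)
qed

lemma gamma_power_6: "gamma_fps ^ 6 = xi_fps ^ 10 * (9 - 8 * xi_fps) ^ 5"
proof -
  have "9 - 8 * fps_to_fls xi_fps = fls_Eq 1 ^ 8 * fls_Eq 6 ^ 4 / (fls_Eq 2 ^ 4 * fls_Eq 3 ^ 8)"
    using fps_to_fls_eqD[OF nine_minus_8_xi] by (simp add: fps_to_fls_hom eq_divide_eq)
  then have "fps_to_fls gamma_fps ^ 6 = fps_to_fls xi_fps ^ 10 * (9 - 8 * fps_to_fls xi_fps) ^ 5"
    by (simp only: gamma_fls xi_fls) (rule field_gamma_6; simp)
  then have "fps_to_fls (gamma_fps ^ 6) = fps_to_fls (xi_fps ^ 10 * (9 - 8 * xi_fps) ^ 5)"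
    by (simp add: fps_to_fls_hom)
  then show ?thesis by (simp only: fps_to_fls_eq_iff)
qed

section \<open>The generating function of PDO\<close>

text \<open>Replaces each part $x$ by $x$ copies of itself, so that the size becomes the sum of the parts.\<close>
definition inflate :: "nat multiset \<Rightarrow> nat multiset" where
  "inflate M = (\<Sum>x\<in>#M. replicate_mset x x)"

lemma count_inflate: "count (inflate M) x = x * count M x"
  by (induction M) (auto simp: inflate_def)

lemma size_inflate: "size (inflate M) = sum_mset M"
  by (induction M) (auto simp: inflate_def)

lemma set_mset_inflate: "0 \<notin># M \<Longrightarrow> set_mset (inflate M) = set_mset M"
  by (auto simp: set_eq_iff count_inflate simp flip: count_greater_zero_iff) (metis not_gr0)

lemma inflate_inject:
  assumes "0 \<notin># M" "0 \<notin># M'" "inflate M = inflate M'"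
  shows "M = M'"
proof (rule multiset_eqI)
  fix x
  have "x * count M x = x * count M' x"
    using arg_cong[OF assms(3), of "\<lambda>M. count M x"] by (simp add: count_inflate)
  then show "count M x = count M' x"
    using assms by (cases "x = 0") (auto simp: not_in_iff)
qed

text \<open>The generating function for a single part size m: j copies offer j designations. The
  constant term is 1, not 0, because an absent part contributes an empty choice.\<close>

definition designated :: "nat \<Rightarrow> rat fps" where
  "designated m = Abs_fps (\<lambda>k. if k = 0 then 1 else if m dvd k then of_nat (k div m) else 0)"

text \<open>A coefficient of the product sums over distributions of the degree n among the parts,
  that is, multisets of size n. A term survives only if each x divides its own multiplicity, and
  those multisets are exactly the inflated partitions.\<close>

lemma designated_prod_nth:
  assumes S: "finite S" "0 \<notin> S"
  shows "fps_nth (\<Prod>m\<in>S. designated m) n =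
    (\<Sum>M | set_mset M \<subseteq> S \<and> sum_mset M = n. \<Prod>x\<in>set_mset M. of_nat (count M x))"
proof -
  let ?P = "{M. set_mset M \<subseteq> S \<and> sum_mset M = n}"
  have zero: "0 \<notin># M" if "M \<in> ?P" for M
    using that S by auto
  have sub: "inflate ` ?P \<subseteq> multisets_of_size S n"
    using zero by (auto simp: multisets_of_size_def size_inflate set_mset_inflate)
  have "fps_nth (\<Prod>m\<in>S. designated m) n =
      (\<Sum>X\<in>multisets_of_size S n. \<Prod>x\<in>S. fps_nth (designated x) (count X x))"
    using S by (rule_tac fps_prod_nth')
  also have "\<dots> = (\<Sum>X\<in>inflate ` ?P. \<Prod>x\<in>S. fps_nth (designated x) (count X x))"
  proof (rule sum.mono_neutral_right)
    show "finite (multisets_of_size S n)"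
      using S by (simp add: finite_multisets_of_size)
    show "\<forall>X\<in>multisets_of_size S n - inflate ` ?P. (\<Prod>x\<in>S. fps_nth (designated x) (count X x)) = 0"
    proof
      fix X assume X: "X \<in> multisets_of_size S n - inflate ` ?P"
      have "\<exists>x\<in>S. \<not> x dvd count X x"
      proof (rule ccontr)
        assume "\<not> ?thesis"
        then have dvd: "x dvd count X x" if "x \<in> S" for x using that by blast
        \<comment> \<open>Dividing all multiplicities exhibits X as an inflation, contrary to its
          choice.\<close>
        define M where "M = (\<Sum>x\<in>S. replicate_mset (count X x div x) x)"
        have "count M x = (if x \<in> S then count X x div x else 0)" for x
          using S by (simp add: M_def count_sum)
        moreover have "count X x = 0" if "x \<notin> S" for x
          using X that by (auto simp: multisets_of_size_def not_in_iff [symmetric])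
        ultimately have "inflate M = X"
          using dvd by (intro multiset_eqI) (simp add: count_inflate)
        moreover have "set_mset M \<subseteq> S"
          using S by (auto simp: M_def set_mset_sum split: if_splits)
        moreover have "sum_mset M = n"
          using X \<open>inflate M = X\<close> size_inflate[of M] by (simp add: multisets_of_size_def)
        ultimately show False using X by auto
      qed
      then obtain x where x: "x \<in> S" "\<not> x dvd count X x" by blast
      then have "count X x \<noteq> 0" by (intro notI) simp
      with x have "fps_nth (designated x) (count X x) = 0"
        by (simp add: designated_def)
      with x S show "(\<Prod>x\<in>S. fps_nth (designated x) (count X x)) = 0"
        by (intro prod_zero) auto
    qed
  qed (fact sub)
  also have "\<dots> = (\<Sum>M\<in>?P. \<Prod>x\<in>S. fps_nth (designated x) (count (inflate M) x))"
    using zero by (subst sum.reindex) (auto simp: inj_on_def intro: inflate_inject)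
  also have "\<dots> = (\<Sum>M\<in>?P. \<Prod>x\<in>set_mset M. of_nat (count M x))"
  proof (rule sum.cong)
    fix M assume M: "M \<in> ?P"
    have "(\<Prod>x\<in>S. fps_nth (designated x) (count (inflate M) x)) =
        (\<Prod>x\<in>set_mset M. fps_nth (designated x) (count (inflate M) x))"
      using M S by (intro prod.mono_neutral_right)
        (auto simp: designated_def count_inflate not_in_iff)
    also have "\<dots> = (\<Prod>x\<in>set_mset M. of_nat (count M x))"
      using zero[OF M] by (intro prod.cong) (auto simp: designated_def count_inflate)
    finally show "(\<Prod>x\<in>S. fps_nth (designated x) (count (inflate M) x)) = \<dots>" .
  qed simp
  finally show ?thesis .
qed

text \<open>1 + x/(1-x)^2 = (1 - x + x^2)/(1-x)^2, and 1 - x + x^2 = (1 + x^3)/(1 + x) is a quotient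
  of factors 1 - x^j.\<close>

lemma designated_1: "designated 1 * ((1 - fps_X) * (1 - fps_X ^ 2) * (1 - fps_X ^ 3)) = 1 - fps_X ^ 6"
proof -
  have "designated 1 * (1 - 2 * fps_X + fps_X ^ 2) = 1 - fps_X + fps_X ^ 2"
  proof (rule fps_ext)
    fix k :: nat
    have "designated 1 * (1 - 2 * fps_X + fps_X ^ 2) =
        designated 1 - 2 * (fps_X * designated 1) + fps_X ^ 2 * designated 1"
      by (simp add: algebra_simps)
    moreover consider "k = 0" | "k = 1" | "k = 2" | j where "k = j + 3"
    proof -
      have "k = 0 \<or> k = 1 \<or> k = 2 \<or> k = (k - 3) + 3" by presburger
      then show thesis using that by blast
    qed
    ultimately show "fps_nth (designated 1 * (1 - 2 * fps_X + fps_X ^ 2)) k =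
        fps_nth (1 - fps_X + fps_X ^ 2 :: rat fps) k"
      by cases (simp_all add: designated_def fps_X_power_mult_nth fps_X_power_nth numeral_fps_const
          fps_mult_left_const_nth algebra_simps)
  qed
  \<comment> \<open>The multiplier turns (1-x)^2 into (1-x)(1-x^2)(1-x^3), and 1 - x + x^2 into
    (1+x^3)(1-x^3) = 1 - x^6.\<close>
  then have "designated 1 * (1 - 2 * fps_X + fps_X ^ 2) * ((1 + fps_X) * (1 - fps_X ^ 3)) =
      (1 - fps_X + fps_X ^ 2) * ((1 + fps_X) * (1 - fps_X ^ 3))"
    by simp
  then show ?thesis
    by (simp add: algebra_simps eval_nat_numeral)
qed

lemma designated_compose: "m > 0 \<Longrightarrow> designated m = designated 1 oo fps_X ^ m"
  by (rule fps_ext) (auto simp: fps_nth_compose_X_power designated_def elim: dvdE)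

lemma designated_mult:
  assumes "m > 0"
  shows "designated m * ((1 - fps_X ^ m) * (1 - fps_X ^ (2 * m)) * (1 - fps_X ^ (3 * m))) = 1 - fps_X ^ (6 * m)"
proof -
  have 0: "fps_nth (fps_X ^ m :: rat fps) 0 = 0" using assms by simp
  show ?thesis
    using arg_cong[OF designated_1, of "\<lambda>f. f oo fps_X ^ m"]
    unfolding designated_compose[OF assms] fps_compose_mult_distrib[OF 0] fps_compose_sub_distrib
      fps_X_power_compose[OF 0] fps_X_fps_compose_startby0[OF 0] fps_compose_1 power_mult [symmetric]
    by (simp only: mult.commute)
qed

definition PDO_fps :: "rat fps" where
  "PDO_fps = Abs_fps (\<lambda>n. of_nat (PDO n))"

lemma PDO_fps_agree: "fps_agree N PDO_fps (\<Prod>m | odd m \<and> m < N. designated m)"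
  unfolding fps_agree_def
proof (intro allI impI)
  fix n assume n: "n < N"
  have "{M. set_mset M \<subseteq> {m. odd m \<and> m < N} \<and> sum_mset M = n} = {M. (\<forall>x\<in>#M. odd x) \<and> sum_mset M = n}"
  proof -
    have "x < N" if "x \<in># M" "sum_mset M = n" for x and M :: "nat multiset"
      using multi_member_split[OF that(1)] that n by auto
    then show ?thesis by auto
  qed
  then show "fps_nth PDO_fps n = fps_nth (\<Prod>m | odd m \<and> m < N. designated m) n"
    by (subst designated_prod_nth) (auto simp: PDO_fps_def PDO_def)
qed

definition odd_qprod :: "nat \<Rightarrow> rat fps" where
  "odd_qprod a = qprod ((*) a ` {m. odd m})"

lemma odd_qprod_agree:
  assumes "a > 0"
  shows "fps_agree N (\<Prod>m | odd m \<and> m < N. 1 - fps_X ^ (a * m)) (odd_qprod a)"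
proof -
  have "(\<Prod>m | odd m \<and> m < N. 1 - fps_X ^ (a * m)) = (\<Prod>m\<in>(*) a ` {m. odd m \<and> m < N}. 1 - fps_X ^ m :: rat fps)"
    using assms by (subst prod.reindex) (auto simp: inj_on_def)
  moreover have "fps_agree N \<dots> (odd_qprod a)"
    unfolding odd_qprod_def
  proof (rule qprod_agree)
    have "m < N" if "a * m < N" for m
    proof -
      have "m \<le> a * m" using assms by simp
      with that show ?thesis by linarith
    qed
    then show "(*) a ` {m. odd m} \<inter> {1..<N} \<subseteq> (*) a ` {m. odd m \<and> m < N}" by auto
  qed (use assms in \<open>auto intro: gr0I\<close>)
  ultimately show ?thesis by simp
qed

lemma PDO_fps_odd_qprod: "PDO_fps * (odd_qprod 1 * odd_qprod 2 * odd_qprod 3) = odd_qprod 6"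
proof (rule fps_agree_eqI)
  fix N :: nat
  let ?S = "{m. odd m \<and> m < N}"
  let ?p = "\<lambda>a. \<Prod>m\<in>?S. 1 - fps_X ^ (a * m) :: rat fps"
  have "(\<Prod>m\<in>?S. designated m) * (?p 1 * ?p 2 * ?p 3) =
      (\<Prod>m\<in>?S. designated m * ((1 - fps_X ^ (1 * m)) * (1 - fps_X ^ (2 * m)) * (1 - fps_X ^ (3 * m))))"
    by (simp only: prod.distrib)
  also have "\<dots> = ?p 6"
    by (intro prod.cong refl, subst mult_1, rule designated_mult) (auto intro: gr0I)
  finally have eq: "(\<Prod>m\<in>?S. designated m) * (?p 1 * ?p 2 * ?p 3) = ?p 6" .
  have "fps_agree N ((\<Prod>m\<in>?S. designated m) * (?p 1 * ?p 2 * ?p 3)) (PDO_fps * (odd_qprod 1 * odd_qprod 2 * odd_qprod 3))"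
    by (intro fps_agree_mult odd_qprod_agree fps_agree_sym[OF PDO_fps_agree]) simp_all
  from fps_agree_sym[OF this] show "fps_agree N (PDO_fps * (odd_qprod 1 * odd_qprod 2 * odd_qprod 3)) (odd_qprod 6)"
    unfolding eq by (rule fps_agree_trans) (rule odd_qprod_agree, simp)
qed

text \<open>Insert O_a = E_a/E_(2a) into O_6/(O_1 O_2 O_3), where O_a is
  \<open>odd_qprod a\<close>.\<close>

theorem PDO_fps_Eq: "PDO_fps * (Eq 1 * Eq 3 * Eq 12) = Eq 4 * Eq 6 ^ 2"
proof -
  have E: "Eq a = odd_qprod a * Eq (2 * a)" if "a > 0" for a
    unfolding odd_qprod_def by (rule Eq_odd_even[OF that])
  have "Eq 2 * (PDO_fps * (Eq 1 * Eq 3 * Eq 12)) = PDO_fps * (Eq 1 * Eq 2 * Eq 3) * Eq 12"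
    by (simp only: mult_ac)
  also have "\<dots> = PDO_fps * (odd_qprod 1 * odd_qprod 2 * odd_qprod 3) * (Eq 2 * Eq 4 * Eq 6 * Eq 12)"
    using E[of 1] E[of 2] E[of 3] by (simp add: mult_ac)
  also have "\<dots> = Eq 2 * (Eq 4 * Eq 6 * (odd_qprod 6 * Eq 12))"
    by (subst PDO_fps_odd_qprod) (simp only: mult_ac)
  also have "odd_qprod 6 * Eq 12 = Eq 6"
    using E[of 6] by simp
  finally show ?thesis by (simp add: power2_eq_square mult.assoc)
qed

section \<open>Integer combinations of powers and the first sections\<close>

lemma of_int_poly_add: "map_poly of_int (p + q) = (map_poly of_int p + map_poly of_int q :: 'a::comm_ring_1 poly)"
  by (simp add: poly_eq_iff coeff_map_poly)

lemma of_int_poly_mult: "map_poly of_int (p * q) = (map_poly of_int p * map_poly of_int q :: 'a::comm_ring_1 poly)"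
  by (simp add: poly_eq_iff coeff_map_poly coeff_mult)

lemma of_int_poly_diff: "map_poly of_int (p - q) = (map_poly of_int p - map_poly of_int q :: 'a::comm_ring_1 poly)"
  by (simp add: poly_eq_iff coeff_map_poly)

lemma of_int_poly_monom: "map_poly of_int (monom c n) = (monom (of_int c) n :: 'a::comm_ring_1 poly)"
  by (simp add: poly_eq_iff coeff_map_poly)

text \<open>Keeping an integer polynomial as witness, with its support in A, allows the same
  polynomial to be moved from xi(q^2) to xi(q).\<close>

definition int_combs :: "nat set \<Rightarrow> 'a::comm_ring_1 \<Rightarrow> 'a set" where
  "int_combs A s = {f. \<exists>p. (\<forall>i. coeff p i \<noteq> 0 \<longrightarrow> i \<in> A) \<and> f = poly (map_poly of_int p) s}"

lemma int_combs_monom: "n \<in> A \<Longrightarrow> of_int c * s ^ n \<in> int_combs A s"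
  unfolding int_combs_def
  by (rule CollectI, rule exI[of _ "monom c n"]) (simp add: of_int_poly_monom poly_monom)

lemma int_combs_0: "0 \<in> int_combs A s"
  unfolding int_combs_def by (rule CollectI, rule exI[of _ 0]) simp

lemma int_combs_add:
  assumes "f \<in> int_combs A s" "g \<in> int_combs A s"
  shows "f + g \<in> int_combs A s"
proof -
  obtain p q where "\<And>i. coeff p i \<noteq> 0 \<Longrightarrow> i \<in> A" "f = poly (map_poly of_int p) s"
      "\<And>i. coeff q i \<noteq> 0 \<Longrightarrow> i \<in> A" "g = poly (map_poly of_int q) s"
    using assms unfolding int_combs_def by blast
  then show ?thesis
    unfolding int_combs_def
    by (intro CollectI exI[of _ "p + q"]) (auto simp: of_int_poly_add, metis add_0)
qed

lemma int_combs_diff: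
  assumes "f \<in> int_combs A s" "g \<in> int_combs A s"
  shows "f - g \<in> int_combs A s"
proof -
  obtain p q where "\<And>i. coeff p i \<noteq> 0 \<Longrightarrow> i \<in> A" "f = poly (map_poly of_int p) s"
      "\<And>i. coeff q i \<noteq> 0 \<Longrightarrow> i \<in> A" "g = poly (map_poly of_int q) s"
    using assms unfolding int_combs_def by blast
  then show ?thesis
    unfolding int_combs_def
    by (intro CollectI exI[of _ "p - q"]) (auto simp: of_int_poly_diff, metis)
qed

lemma int_combs_mult:
  assumes "f \<in> int_combs A s" "g \<in> int_combs B s" and AB: "\<And>i j. i \<in> A \<Longrightarrow> j \<in> B \<Longrightarrow> i + j \<in> C"
  shows "f * g \<in> int_combs C s"
proof -
  obtain p q where p: "\<And>i. coeff p i \<noteq> 0 \<Longrightarrow> i \<in> A" "f = poly (map_poly of_int p) s"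
      and q: "\<And>i. coeff q i \<noteq> 0 \<Longrightarrow> i \<in> B" "g = poly (map_poly of_int q) s"
    using assms(1,2) unfolding int_combs_def by blast
  have "i \<in> C" if nz: "coeff (p * q) i \<noteq> 0" for i
  proof -
    have "\<exists>j\<in>{..i}. coeff p j * coeff q (i - j) \<noteq> 0"
    proof (rule ccontr)
      assume "\<not> ?thesis"
      then have "coeff (p * q) i = 0"
        unfolding coeff_mult by (intro sum.neutral) blast
      with nz show False by contradiction
    qed
    then obtain j where "j \<le> i" "coeff p j \<noteq> 0" "coeff q (i - j) \<noteq> 0" by auto
    then show ?thesis using AB[of j "i - j"] p(1) q(1) by simp
  qed
  then show ?thesis
    unfolding int_combs_def p(2) q(2)
    by (intro CollectI exI[of _ "p * q"]) (simp add: of_int_poly_mult)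
qed

lemma int_combs_power:
  assumes "f \<in> int_combs {..a} s"
  shows "f ^ n \<in> int_combs {..a * n} s"
proof (induction n)
  case 0
  show ?case using int_combs_monom[of 0 "{..a * 0}" 1 s] by simp
next
  case (Suc n)
  have "f * f ^ n \<in> int_combs {..a * Suc n} s"
    by (rule int_combs_mult[OF assms Suc]) auto
  then show ?case by simp
qed

lemma int_combs_mono: "f \<in> int_combs A s \<Longrightarrow> A \<subseteq> B \<Longrightarrow> f \<in> int_combs B s"
  unfolding int_combs_def by blast

text \<open>Taking even parts is additive, so claims about it reduce to single powers of s by this
  rule.\<close>

lemma int_combs_induct [consumes 1, case_names zero add]:
  assumes "f \<in> int_combs A s" and "P 0"
    and "\<And>f c n. P f \<Longrightarrow> n \<in> A \<Longrightarrow> P (of_int c * s ^ n + f)"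
  shows "P f"
proof -
  obtain p where p: "\<And>i. coeff p i \<noteq> 0 \<Longrightarrow> i \<in> A" "f = poly (map_poly of_int p) s"
    using assms(1) unfolding int_combs_def by blast
  have "P (\<Sum>i\<in>I. of_int (coeff p i) * s ^ i)" if "finite I" for I
    using that
  proof (induction I rule: finite_induct)
    case (insert i I)
    then show ?case
      using assms(3)[OF insert.IH, of i "coeff p i"] p(1)[of i] by (cases "coeff p i = 0") auto
  qed (simp add: assms(2))
  moreover have "f = (\<Sum>i\<le>degree p. of_int (coeff p i) * s ^ i)"
  proof -
    have "f = (\<Sum>i\<le>degree (map_poly of_int p :: 'a poly). of_int (coeff p i) * s ^ i)"
      by (simp add: p(2) poly_altdef coeff_map_poly)
    also have "\<dots> = (\<Sum>i\<le>degree p. of_int (coeff p i) * s ^ i)"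
    proof (rule sum.mono_neutral_left)
      show "\<forall>i\<in>{..degree p} - {..degree (map_poly of_int p :: 'a poly)}. of_int (coeff p i) * s ^ i = 0"
      proof
        fix i assume "i \<in> {..degree p} - {..degree (map_poly of_int p :: 'a poly)}"
        then have "coeff (map_poly of_int p :: 'a poly) i = 0" by (intro coeff_eq_0) auto
        then show "of_int (coeff p i) * s ^ i = 0" by (simp add: coeff_map_poly)
      qed
    qed (auto intro: map_poly_degree_leq[THEN order.trans])
    finally show ?thesis .
  qed
  ultimately show ?thesis by simp
qed

lemma poly_of_int_compose:
  assumes "fps_nth h 0 = 0"
  shows "poly (map_poly of_int p) (f :: rat fps) oo h = poly (map_poly of_int p) (f oo h)"
proof (induction p)
  case (pCons a p)
  then show ?case
    using assms by (simp add: map_poly_pCons fps_compose_add_distrib fps_compose_mult_distrib fps_of_int [symmetric])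
qed simp

section \<open>Uniqueness of the polynomial in xi\<close>

lemma xi_nth_0 [simp]: "fps_nth xi_fps 0 = 1"
  by (simp add: xi_fps_def fps_power_zeroth)

lemma dissect_nth_0 [simp]: "fps_nth dissect 0 = 0"
  by (simp add: dissect_def)

lemma dissect_nonzero: "dissect \<noteq> 0"
proof
  assume "dissect = 0"
  then have "fps_X * Eq 2 ^ 2 * Eq 12 ^ 4 = 0" using dissect_mult by simp
  then show False by simp
qed

text \<open>Otherwise xi(q^2) = 1 as well, and xi(q^2)(1 - h^2) = 1 forces h = 0.\<close>

lemma xi_neq_1: "xi_fps \<noteq> 1"
proof
  assume "xi_fps = 1"
  then have "1 - dissect ^ 2 = 1" using xi_compose_dissect by simp
  then show False using dissect_nonzero by simp
qed

lemma poly_xi_nth_0: "fps_nth (poly (map_poly of_int p) xi_fps) 0 = of_int (poly p 1)"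
  by (induction p) (simp_all add: map_poly_pCons fps_of_int [symmetric])

text \<open>The constant term of p(xi) is p(1), as xi has constant term 1. So x - 1 divides p, and
  xi - 1 can be cancelled in the integral domain of power series; descend on the degree.\<close>

lemma poly_xi_eq_0:
  assumes "poly (map_poly of_int p) xi_fps = 0"
  shows "p = 0"
  using assms
proof (induction "degree p" arbitrary: p rule: less_induct)
  case less
  have "of_int (poly p 1) = (0 :: rat)"
    using poly_xi_nth_0[of p] less.prems by simp
  then have "[:- 1, 1:] dvd p" by (simp add: poly_eq_0_iff_dvd)
  then obtain q where q: "p = [:- 1, 1:] * q" by blast
  have "(xi_fps - 1) * poly (map_poly of_int q) xi_fps = 0"
    using less.prems unfolding q of_int_poly_mult by (auto simp: map_poly_pCons)
  then have "poly (map_poly of_int q) xi_fps = 0"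
    using xi_neq_1 by (simp only: mult_eq_0_iff right_minus_eq simp_thms)
  moreover have "degree q < degree p" if "q \<noteq> 0"
    using that unfolding q by (subst degree_mult_eq) auto
  ultimately have "q = 0" using less.hyps by blast
  then show ?case by (simp add: q)
qed

lemma poly_xi_inject:
  "poly (map_poly of_int p) xi_fps = poly (map_poly of_int q) xi_fps \<Longrightarrow> p = q"
  using poly_xi_eq_0[of "p - q"] by (simp add: of_int_poly_diff)

section \<open>The sections P_k and the closed forms of P_1 and P_2\<close>

definition PDO_section :: "nat \<Rightarrow> rat fps" where
  "PDO_section k = Abs_fps (\<lambda>n. of_nat (PDO (2 ^ k * n)))"

text \<open>Adding f(-q) to f(q) doubles the even coefficients and cancels the odd ones.\<close>

lemma PDO_section_Suc:
  "2 * (PDO_section (Suc k) oo fps_X ^ 2) = PDO_section k + (PDO_section k oo (- fps_X))"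
proof (rule fps_ext)
  fix n
  show "fps_nth (2 * (PDO_section (Suc k) oo fps_X ^ 2)) n =
      fps_nth (PDO_section k + (PDO_section k oo (- fps_X))) n"
    by (cases "even n")
      (auto simp: fps_compose_uminus' fps_nth_compose_X_power PDO_section_def numeral_fps_const
        fps_mult_left_const_nth mult_ac elim!: evenE)
qed

text \<open>Two expressions for xi(q^2) are compared: 1/(1 - h^2), and (1 + 3H)/(1 + H)^2 with H =
  h(q^2).\<close>

lemma dissect_square: "dissect ^ 2 * (1 + 3 * (dissect oo fps_X ^ 2)) =
  (dissect oo fps_X ^ 2) * (1 - (dissect oo fps_X ^ 2))"
proof -
  let ?H = "dissect oo fps_X ^ 2" and ?s = "xi_fps oo fps_X ^ 2"
  have "?s * (1 + ?H) ^ 2 = 1 + 3 * ?H"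
    using arg_cong[OF xi_dissect, of "\<lambda>f. f oo fps_X ^ 2"] by (simp add: compose_square_simps)
  then have "(1 + 3 * ?H) * (1 - dissect ^ 2) = (?s * (1 - dissect ^ 2)) * (1 + ?H) ^ 2"
    by (simp add: mult_ac)
  also have "\<dots> = (1 + ?H) ^ 2" by (simp add: xi_compose_dissect)
  finally show ?thesis
    by (simp add: algebra_simps power2_eq_square)
qed

lemma field_even_part:
  fixes h :: "'a::field"
  assumes nz: "1 + h \<noteq> 0" "1 - h \<noteq> 0"
  shows "(1 + 3 * h) / (1 + h) + (1 - 3 * h) / (1 - h) = 2 * ((1 - 3 * h ^ 2) / (1 - h ^ 2))"
proof -
  have e: "1 - h ^ 2 = (1 + h) * (1 - h)"
    by (simp add: algebra_simps power2_eq_square)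
  show ?thesis
    unfolding e using nz by (simp add: add_frac_eq) (simp add: algebra_simps power2_eq_square)
qed

text \<open>Here p, p' and w are P_0(q), P_0(-q) and P_1(q^2). In terms of h and H only p^2, p'^2
  and pp' have closed forms, so w is reached through its square; h^2 is then eliminated in favour of
  H.\<close>

lemma field_even_square:
  fixes h :: "'a::field_char_0"
  assumes nz: "1 + h \<noteq> 0" "1 - h \<noteq> 0" "1 + H \<noteq> 0" "1 + 3 * H \<noteq> 0"
    and rel: "h ^ 2 * (1 + 3 * H) = H * (1 - H)"
    and p: "p ^ 2 = T * ((1 + 3 * h) / (1 + h))" and p': "p' ^ 2 = T * ((1 - 3 * h) / (1 - h))"
    and pp: "p * p' = T * ((1 - 3 * H) / (1 + H))"
    and w: "2 * w = p + p'"
  shows "w ^ 2 = T * ((1 - H) / (1 + H) ^ 2)"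
proof -
  have "(1 - h ^ 2) * (1 + 3 * H) = (1 + 3 * H) - h ^ 2 * (1 + 3 * H)" by (simp add: algebra_simps)
  then have a: "(1 - h ^ 2) * (1 + 3 * H) = (1 + H) ^ 2"
    unfolding rel by (simp add: algebra_simps power2_eq_square)
  have "(1 - 3 * h ^ 2) * (1 + 3 * H) = (1 + 3 * H) - 3 * (h ^ 2 * (1 + 3 * H))" by (simp add: algebra_simps)
  then have b: "(1 - 3 * h ^ 2) * (1 + 3 * H) = 1 + 3 * H ^ 2"
    unfolding rel by (simp add: algebra_simps power2_eq_square)
  have c: "(1 - 3 * h ^ 2) / (1 - h ^ 2) = (1 + 3 * H ^ 2) / (1 + H) ^ 2"
    unfolding a [symmetric] b [symmetric] using nz by simp
  have "4 * w ^ 2 = (2 * w) ^ 2" by (simp add: power2_eq_square)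
  also have "\<dots> = p ^ 2 + p' ^ 2 + 2 * (p * p')" unfolding w by (simp add: power2_eq_square algebra_simps)
  also have "\<dots> = T * ((1 + 3 * h) / (1 + h) + (1 - 3 * h) / (1 - h)) + 2 * (T * ((1 - 3 * H) / (1 + H)))"
    unfolding p p' pp by (simp only: distrib_left)
  also have "\<dots> = 2 * (T * ((1 + 3 * H ^ 2) / (1 + H) ^ 2 + (1 - 3 * H) / (1 + H)))"
    unfolding field_even_part[OF nz(1,2)] c by (simp only: distrib_left mult_ac)
  also have "(1 - 3 * H) / (1 + H) = (1 - 3 * H) * (1 + H) / (1 + H) ^ 2"
    using nz by (simp add: power2_eq_square)
  also have "(1 + 3 * H ^ 2) / (1 + H) ^ 2 + (1 - 3 * H) * (1 + H) / (1 + H) ^ 2 = 2 * ((1 - H) / (1 + H) ^ 2)"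
    by (simp add: add_divide_distrib [symmetric]) (simp add: algebra_simps power2_eq_square)
  finally have "(2 * 2) * w ^ 2 = (2 * 2) * (T * ((1 - H) / (1 + H) ^ 2))"
    by (simp add: mult_ac)
  then show ?thesis
    by (subst (asm) mult_left_cancel) simp_all
qed

lemma PDO_fls:
  "fps_to_fls PDO_fps = fls_Eq 4 * fls_Eq 6 ^ 2 / (fls_Eq 1 * fls_Eq 3 * fls_Eq 12)"
  using fps_to_fls_eqD[OF PDO_fps_Eq] by (simp add: fps_to_fls_hom eq_divide_eq)

lemma PDO_uminus_fls:
  "fps_to_fls (PDO_fps oo (- fps_X)) = fls_Eq 1 * fls_Eq 3 * fls_Eq 4 ^ 2 / (fls_Eq 2 ^ 3 * fls_Eq 6)"
proof -
  have "(PDO_fps oo (- fps_X)) * ((Eq 1 oo (- fps_X)) * (Eq 3 oo (- fps_X)) * Eq 12) = Eq 4 * Eq 6 ^ 2"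
    using arg_cong[OF PDO_fps_Eq, of "\<lambda>f. f oo - fps_X"] by (simp add: compose_uminus_simps)
  from fps_to_fls_eqD[OF this]
  have *: "fps_to_fls (PDO_fps oo (- fps_X)) *
      (fls_Eq 2 ^ 3 / (fls_Eq 1 * fls_Eq 4) * (fls_Eq 6 ^ 3 / (fls_Eq 3 * fls_Eq 12)) * fls_Eq 12) =
      fls_Eq 4 * fls_Eq 6 ^ 2"
    using fls_Eq_odd_compose_uminus[of 1] fls_Eq_odd_compose_uminus[of 3]
    by (simp add: fps_to_fls_hom del: One_nat_def times_divide_eq_left times_divide_eq_right)
  have f: "v = e1 * e3 * e4 ^ 2 / (e2 ^ 3 * e6)"
    if "v * (e2 ^ 3 / (e1 * e4) * (e6 ^ 3 / (e3 * e12)) * e12) = e4 * e6 ^ 2"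
      "e1 \<noteq> 0" "e2 \<noteq> 0" "e3 \<noteq> 0" "e4 \<noteq> 0" "e6 \<noteq> 0" "e12 \<noteq> 0" for v e1 e2 e3 e4 e6 e12 :: "rat fls"
  proof -
    have "v = e4 * e6 ^ 2 / (e2 ^ 3 / (e1 * e4) * (e6 ^ 3 / (e3 * e12)) * e12)"
      by (rule eq_divide_imp[OF _ that(1)]) (use that(2-) in simp)
    also have "\<dots> = e1 * e3 * e4 ^ 2 / (e2 ^ 3 * e6)"
      using that(2-) by (simp add: field_simps eval_nat_numeral)
    finally show ?thesis .
  qed
  show ?thesis by (rule f[OF *]) simp_all
qed

lemma PDO_compose_fls:
  "fps_to_fls (PDO_fps oo fps_X ^ 2) = fls_Eq 8 * fls_Eq 12 ^ 2 / (fls_Eq 2 * fls_Eq 6 * fls_Eq 24)"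
proof -
  have "(PDO_fps oo fps_X ^ 2) * (Eq 2 * Eq 6 * Eq 24) = Eq 8 * Eq 12 ^ 2"
    using arg_cong[OF PDO_fps_Eq, of "\<lambda>f. f oo fps_X ^ 2"] by (simp add: compose_square_simps)
  from fps_to_fls_eqD[OF this] show ?thesis by (simp add: fps_to_fls_hom eq_divide_eq)
qed

lemma PDO_nth_0: "fps_nth PDO_fps 0 = 1"
  using arg_cong[OF PDO_fps_Eq, of "\<lambda>f. fps_nth f 0"] by (simp add: fps_power_zeroth)

lemma PDO_section_0: "PDO_section 0 = PDO_fps"
  by (simp add: PDO_section_def PDO_fps_def)

lemma dissect_fls_nz:
  "1 + fps_to_fls dissect \<noteq> 0" "1 - fps_to_fls dissect \<noteq> 0"
  "1 + fps_to_fls (dissect oo fps_X ^ 2) \<noteq> 0" 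
  by (simp_all add: one_plus_dissect_fls one_minus_dissect_fls one_plus_dissect_compose_fls)

text \<open>The squares of both sides agree; the sign is settled by the constant term, which is
  1.\<close>

lemma PDO_section_1: "PDO_section 1 = PDO_fps ^ 2"
proof -
  let ?h = "fps_to_fls dissect" and ?H = "fps_to_fls (dissect oo fps_X ^ 2)"
  let ?T = "fls_Eq 4 ^ 5 * fls_Eq 6 ^ 5 / (fls_Eq 2 ^ 7 * fls_Eq 12 ^ 3)"
  have rel: "?h ^ 2 * (1 + 3 * ?H) = ?H * (1 - ?H)"
    using fps_to_fls_eqD[OF dissect_square] by (simp add: fps_to_fls_hom)
  have "1 + 3 * ?H \<noteq> 0"
  proof
    assume "1 + 3 * ?H = 0"
    then have "fps_to_fls (1 + 3 * (dissect oo fps_X ^ 2)) = fps_to_fls 0" by (simp add: fps_to_fls_hom)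
    then have "1 + 3 * (dissect oo fps_X ^ 2) = 0" by (simp only: fps_to_fls_eq_iff)
    then have "fps_nth (1 + 3 * (dissect oo fps_X ^ 2)) 0 = 0" by simp
    then show False by simp
  qed
  moreover have "fps_to_fls PDO_fps ^ 2 = ?T * ((1 + 3 * ?h) / (1 + ?h))"
    unfolding PDO_fls one_plus_3_dissect_fls one_plus_dissect_fls by (rule field_PDO_square(1)) simp_all
  moreover have "fps_to_fls (PDO_fps oo (- fps_X)) ^ 2 = ?T * ((1 - 3 * ?h) / (1 - ?h))"
    unfolding PDO_uminus_fls one_minus_3_dissect_fls one_minus_dissect_fls by (rule field_PDO_square(2)) simp_all
  moreover have "fps_to_fls PDO_fps * fps_to_fls (PDO_fps oo (- fps_X)) = ?T * ((1 - 3 * ?H) / (1 + ?H))"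
    unfolding PDO_fls PDO_uminus_fls one_minus_3_dissect_compose_fls one_plus_dissect_compose_fls
    by (rule field_PDO_mult(1)) simp_all
  moreover have "2 * fps_to_fls (PDO_section 1 oo fps_X ^ 2) = fps_to_fls PDO_fps + fps_to_fls (PDO_fps oo (- fps_X))"
    using fps_to_fls_eqD[OF PDO_section_Suc[of 0]] by (simp add: fps_to_fls_hom PDO_section_0)
  ultimately have "fps_to_fls (PDO_section 1 oo fps_X ^ 2) ^ 2 = ?T * ((1 - ?H) / (1 + ?H) ^ 2)"
    by (intro field_even_square[OF dissect_fls_nz _ rel])
  also have "\<dots> = (fps_to_fls (PDO_fps oo fps_X ^ 2) ^ 2) ^ 2"
  proof -
    have "fps_to_fls (PDO_fps oo fps_X ^ 2) ^ 2 = fls_Eq 8 ^ 2 * fls_Eq 12 ^ 4 / (fls_Eq 2 ^ 2 * fls_Eq 6 ^ 2 * fls_Eq 24 ^ 2)"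
      by (simp add: PDO_compose_fls power_divide power_mult_distrib flip: power_mult)
    then show ?thesis
      unfolding one_minus_dissect_compose_fls one_plus_dissect_compose_fls
      by (simp only:) (rule field_PDO_mult(2)[of "fls_Eq 1" _ "fls_Eq 3"]; simp)
  qed
  finally have "fps_to_fls ((PDO_section 1 ^ 2) oo fps_X ^ 2) = fps_to_fls (((PDO_fps ^ 2) ^ 2) oo fps_X ^ 2)"
    by (simp add: fps_to_fls_hom fps_compose_power [symmetric])
  then have "PDO_section 1 ^ 2 = (PDO_fps ^ 2) ^ 2"
    by (simp only: fps_to_fls_eq_iff fps_compose_X_power_inject zero_less_numeral)
  then have "PDO_section 1 = PDO_fps ^ 2 \<or> PDO_section 1 = - (PDO_fps ^ 2)"
    by (rule power2_eq_iff[THEN iffD1])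
  moreover have "fps_nth (PDO_section 1) 0 = fps_nth PDO_fps 0"
    by (simp add: PDO_section_def PDO_fps_def)
  ultimately show ?thesis
    using PDO_nth_0 by (auto simp: power2_eq_square)
qed

text \<open>As P_1 = P_0^2, its even part averages T(1 + 3h)/(1 + h) and T(1 - 3h)/(1 - h), giving
  T(1 - 3h^2)/(1 - h^2). With s = 1/(1 - h^2) this is T(3 - 2s), and gamma(q^2) T = s^2.\<close>

lemma gamma_PDO_section_2: "gamma_fps * PDO_section 2 = xi_fps ^ 2 * (3 - 2 * xi_fps)"
proof -
  let ?h = "fps_to_fls dissect" and ?s = "fps_to_fls (xi_fps oo fps_X ^ 2)"
    and ?g = "fps_to_fls (gamma_fps oo fps_X ^ 2)"
  let ?T = "fls_Eq 4 ^ 5 * fls_Eq 6 ^ 5 / (fls_Eq 2 ^ 7 * fls_Eq 12 ^ 3)"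
  have "PDO_section 1 oo (- fps_X) = (PDO_fps oo (- fps_X)) ^ 2"
    by (simp add: PDO_section_1 fps_compose_power [symmetric] del: One_nat_def)
  then have "2 * fps_to_fls (PDO_section 2 oo fps_X ^ 2) =
      fps_to_fls PDO_fps ^ 2 + fps_to_fls (PDO_fps oo (- fps_X)) ^ 2"
    using fps_to_fls_eqD[OF PDO_section_Suc[of 1]] PDO_section_1
    by (simp add: fps_to_fls_hom Suc_1 del: One_nat_def)
  also have "fps_to_fls PDO_fps ^ 2 = ?T * ((1 + 3 * ?h) / (1 + ?h))"
    unfolding PDO_fls one_plus_3_dissect_fls one_plus_dissect_fls by (rule field_PDO_square(1)) simp_all
  also have "fps_to_fls (PDO_fps oo (- fps_X)) ^ 2 = ?T * ((1 - 3 * ?h) / (1 - ?h))"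
    unfolding PDO_uminus_fls one_minus_3_dissect_fls one_minus_dissect_fls by (rule field_PDO_square(2)) simp_all
  also have "?T * ((1 + 3 * ?h) / (1 + ?h)) + ?T * ((1 - 3 * ?h) / (1 - ?h)) =
      2 * (?T * ((1 - 3 * ?h ^ 2) / (1 - ?h ^ 2)))"
    using field_even_part[OF dissect_fls_nz(1,2)] by (simp only: distrib_left [symmetric] mult.left_commute)
  finally have sec: "fps_to_fls (PDO_section 2 oo fps_X ^ 2) = ?T * ((1 - 3 * ?h ^ 2) / (1 - ?h ^ 2))"
    by (rule mult_left_cancel[OF zero_neq_numeral [symmetric], THEN iffD1])
  have s: "?s * (1 - ?h ^ 2) = 1"
    using fps_to_fls_eqD[OF xi_compose_dissect] by (simp add: fps_to_fls_hom)
  then have nz: "1 - ?h ^ 2 \<noteq> 0" by auto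
  have s': "inverse (1 - ?h ^ 2) = ?s"
    using s by (metis inverse_unique mult.commute)
  have "?g * fps_to_fls (PDO_section 2 oo fps_X ^ 2) = ?g * ?T * ((1 - 3 * ?h ^ 2) * ?s)"
    unfolding sec divide_inverse[of "1 - 3 * ?h ^ 2"] s' by (simp only: mult.assoc)
  also have "?g * ?T = ?s ^ 2"
    unfolding gamma_compose_fls xi_compose_fls by (rule field_gamma_T) simp_all
  also have "(1 - 3 * ?h ^ 2) * ?s = 3 * (?s * (1 - ?h ^ 2)) - 2 * ?s"
    by (simp add: algebra_simps)
  also have "\<dots> = 3 - 2 * ?s" by (simp only: s mult_1_right)
  finally have "fps_to_fls ((gamma_fps * PDO_section 2) oo fps_X ^ 2) =
      fps_to_fls ((xi_fps ^ 2 * (3 - 2 * xi_fps)) oo fps_X ^ 2)"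
    by (simp add: fps_to_fls_hom compose_square_simps)
  then show ?thesis
    by (simp only: fps_to_fls_eq_iff fps_compose_X_power_inject zero_less_numeral)
qed

section \<open>The recursion and the order bound\<close>

abbreviation "xi_sq \<equiv> xi_fps oo fps_X ^ 2"

text \<open>The exponents of $\xi$ occurring in $\gamma^W P_{k+2}$ for $W = 2^k$.\<close>
definition xi_range :: "nat \<Rightarrow> nat set" where
  "xi_range W = {i. 5 * W \<le> 3 * i \<and> i \<le> 3 * W}"

lemma int_combs_smult: "f \<in> int_combs A s \<Longrightarrow> of_int c * f \<in> int_combs A s"
  using int_combs_mult[of "of_int c" "{0}" s f A A] int_combs_monom[of 0 "{0}" c s] by simp

lemma of_int_compose: "(of_int c :: rat fps) oo h = of_int c"
  by (simp flip: fps_of_int)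

lemma xi_sq_dissect: "xi_sq * dissect ^ 2 = xi_sq - 1"
  using xi_compose_dissect by (simp add: algebra_simps)

text \<open>For n = 2j the exponents of s run from 6W - j to 6W = 3(2W). From 6j <= 21W - 3i and 3i
  >= 5W follows 3j <= 8W, so 3(6W - j) >= 5(2W).\<close>

lemma dissect_power_even_part:
  assumes i: "i \<in> xi_range W" and n: "n + i \<le> 7 * W"
  shows "\<exists>g\<in>int_combs (xi_range (2 * W)) xi_sq. xi_sq ^ (6 * W) * (dissect ^ n + (- dissect) ^ n) = 2 * g"
proof (cases "even n")
  case True
  then obtain j where j: "n = 2 * j" by blast
  have "j \<le> 6 * W" using n j by simp
  then have "xi_sq ^ (6 * W) = xi_sq ^ (6 * W - j) * xi_sq ^ j"
    by (simp flip: power_add)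
  then have "xi_sq ^ (6 * W) * dissect ^ n = xi_sq ^ (6 * W - j) * (xi_sq * dissect ^ 2) ^ j"
    by (simp add: j power_mult_distrib power_mult)
  also have "\<dots> = xi_sq ^ (6 * W - j) * (xi_sq - 1) ^ j" by (simp only: xi_sq_dissect)
  finally have "xi_sq ^ (6 * W) * (dissect ^ n + (- dissect) ^ n) = 2 * (xi_sq ^ (6 * W - j) * (xi_sq - 1) ^ j)"
    using True by (simp add: distrib_left)
  moreover have "xi_sq ^ (6 * W - j) * (xi_sq - 1) ^ j \<in> int_combs (xi_range (2 * W)) xi_sq"
  proof (rule int_combs_mult[where A = "{6 * W - j}" and B = "{..1 * j}"])
    show "xi_sq ^ (6 * W - j) \<in> int_combs {6 * W - j} xi_sq"
      using int_combs_monom[of "6 * W - j" "{6 * W - j}" 1 xi_sq] by simp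
    have "of_int 1 * xi_sq ^ 1 - of_int 1 * xi_sq ^ 0 \<in> int_combs {..1} xi_sq"
      by (intro int_combs_diff int_combs_monom) auto
    then show "(xi_sq - 1) ^ j \<in> int_combs {..1 * j} xi_sq"
      by (intro int_combs_power) simp
  next
    fix a b assume ab: "a \<in> {6 * W - j}" "b \<in> {..1 * j}"
    have "6 * j + 3 * i \<le> 21 * W" "5 * W \<le> 3 * i" using n j i by (auto simp: xi_range_def)
    then show "a + b \<in> xi_range (2 * W)" using ab \<open>j \<le> 6 * W\<close> by (auto simp: xi_range_def)
  qed
  ultimately show ?thesis by blast
next
  case False
  then have "xi_sq ^ (6 * W) * (dissect ^ n + (- dissect) ^ n) = 2 * 0" by simp
  then show ?thesis using int_combs_0 by blast
qed

lemma dissect_poly_even_part: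
  assumes i: "i \<in> xi_range W" and r: "r \<in> int_combs {..7 * W - i} dissect"
  shows "\<exists>g\<in>int_combs (xi_range (2 * W)) xi_sq. xi_sq ^ (6 * W) * (r + (r oo (- fps_X))) = 2 * g"
  using r
proof (induction r rule: int_combs_induct)
  case zero
  show ?case by (rule bexI[OF _ int_combs_0]) simp
next
  case (add r c n)
  \<comment> \<open>This makes the truncated difference 7W - i genuine.\<close>
  have "i \<le> 3 * W" using i by (simp add: xi_range_def)
  then have "n + i \<le> 7 * W" using add.hyps by auto
  from dissect_power_even_part[OF i this] obtain g1 where
    g1: "g1 \<in> int_combs (xi_range (2 * W)) xi_sq" "xi_sq ^ (6 * W) * (dissect ^ n + (- dissect) ^ n) = 2 * g1" ..
  from add.IH obtain g2 where
    g2: "g2 \<in> int_combs (xi_range (2 * W)) xi_sq" "xi_sq ^ (6 * W) * (r + (r oo (- fps_X))) = 2 * g2" ..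
  have "(of_int c * dissect ^ n + r) oo (- fps_X) = of_int c * (- dissect) ^ n + (r oo (- fps_X))"
    by (simp add: compose_uminus_simps of_int_compose)
  then have "xi_sq ^ (6 * W) * (of_int c * dissect ^ n + r + ((of_int c * dissect ^ n + r) oo (- fps_X))) =
      of_int c * (xi_sq ^ (6 * W) * (dissect ^ n + (- dissect) ^ n)) + xi_sq ^ (6 * W) * (r + (r oo (- fps_X)))"
    by (simp only: algebra_simps)
  also have "\<dots> = 2 * (of_int c * g1 + g2)"
    unfolding g1(2) g2(2) by (simp only: algebra_simps)
  finally show ?case
    using int_combs_add[OF int_combs_smult[OF g1(1)] g2(1)] by blast
qed

lemma xi_sq_compose_uminus: "xi_sq oo (- fps_X) = xi_sq"
  by (rule fps_even_compose_uminus)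

text \<open>The extra factor equals (1 - h)^(-5W), as s(1 - h)(1 + h) = 1. It converts gamma^W into
  gamma(q^2)^(2W), which is even.\<close>

lemma xi_power_even_part:
  assumes i: "i \<in> xi_range W"
  defines "G \<equiv> xi_fps ^ i * ((1 + dissect) ^ (5 * W) * xi_sq ^ (5 * W))"
  shows "\<exists>g\<in>int_combs (xi_range (2 * W)) xi_sq. G + (G oo (- fps_X)) = 2 * g"
proof -
  define r where "r = (1 - dissect) ^ W * (1 + dissect) ^ (6 * W - 2 * i) * (1 + 3 * dissect) ^ i"
  have i_le: "2 * i \<le> 6 * W" using i by (simp add: xi_range_def)
  have "G = xi_sq ^ (6 * W) * r"
  proof -
    have "xi_sq * (1 - dissect) * (1 + dissect) = 1"
      using xi_compose_dissect by (simp add: algebra_simps power2_eq_square)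
    \<comment> \<open>Multiplying by this form of 1 raises the power of 1 + h to 6W, enough to clear
      the denominator (1 + h)^(2i) of xi^i because i <= 3W.\<close>
    then have "G = G * (xi_sq * (1 - dissect) * (1 + dissect)) ^ W" by simp
    also have "\<dots> = xi_sq ^ (5 * W + W) * (1 - dissect) ^ W * (xi_fps ^ i * (1 + dissect) ^ (5 * W + W))"
      by (simp only: G_def power_mult_distrib power_add mult_ac)
    also have "(1 + dissect) ^ (5 * W + W) = (1 + dissect) ^ (6 * W - 2 * i) * ((1 + dissect) ^ 2) ^ i"
      using i_le by (simp flip: power_add power_mult)
    also have "xi_fps ^ i * ((1 + dissect) ^ (6 * W - 2 * i) * ((1 + dissect) ^ 2) ^ i) =
        (1 + dissect) ^ (6 * W - 2 * i) * (xi_fps * (1 + dissect) ^ 2) ^ i"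
      by (simp only: power_mult_distrib mult_ac)
    also have "(xi_fps * (1 + dissect) ^ 2) ^ i = (1 + 3 * dissect) ^ i"
      by (simp only: xi_dissect)
    finally show ?thesis by (simp add: r_def mult_ac)
  qed
  then have "G + (G oo (- fps_X)) = xi_sq ^ (6 * W) * (r + (r oo (- fps_X)))"
    by (simp add: fps_compose_mult_distrib fps_compose_power [symmetric] xi_sq_compose_uminus distrib_left)
  moreover have "r \<in> int_combs {..7 * W - i} dissect"
  proof -
    have lin: "1 + of_int c * dissect \<in> int_combs {..1} dissect" for c
    proof -
      have "of_int 1 * dissect ^ 0 + of_int c * dissect ^ 1 \<in> int_combs {..1} dissect"
        by (intro int_combs_add int_combs_monom) auto
      then show ?thesis by simp
    qed
    have "(1 + of_int (- 1) * dissect) ^ W * (1 + of_int 1 * dissect) ^ (6 * W - 2 * i) \<in>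
        int_combs {..1 * W + 1 * (6 * W - 2 * i)} dissect"
      by (rule int_combs_mult[OF int_combs_power[OF lin] int_combs_power[OF lin]]) auto
    then have "(1 + of_int (- 1) * dissect) ^ W * (1 + of_int 1 * dissect) ^ (6 * W - 2 * i) *
        (1 + of_int 3 * dissect) ^ i \<in> int_combs {..7 * W - i} dissect"
      by (rule int_combs_mult[OF _ int_combs_power[OF lin]]) (use i_le in auto)
    then show ?thesis by (simp add: r_def)
  qed
  ultimately show ?thesis
    using dissect_poly_even_part[OF i] by simp
qed

lemma xi_poly_even_part:
  assumes "f \<in> int_combs (xi_range W) xi_fps"
  defines "c \<equiv> (1 + dissect) ^ (5 * W) * xi_sq ^ (5 * W)"
  shows "\<exists>g\<in>int_combs (xi_range (2 * W)) xi_sq. f * c + ((f * c) oo (- fps_X)) = 2 * g"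
  using assms(1)
proof (induction f rule: int_combs_induct)
  case zero
  show ?case by (rule bexI[OF _ int_combs_0]) simp
next
  case (add f a n)
  from xi_power_even_part[OF add.hyps] obtain g1 where
    g1: "g1 \<in> int_combs (xi_range (2 * W)) xi_sq" "xi_fps ^ n * c + ((xi_fps ^ n * c) oo (- fps_X)) = 2 * g1"
    unfolding c_def ..
  from add.IH obtain g2 where
    g2: "g2 \<in> int_combs (xi_range (2 * W)) xi_sq" "f * c + ((f * c) oo (- fps_X)) = 2 * g2" ..
  have "(of_int a * xi_fps ^ n + f) * c = of_int a * (xi_fps ^ n * c) + f * c"
    by (simp only: algebra_simps)
  moreover have "(of_int a * (xi_fps ^ n * c) + f * c) oo (- fps_X) =
      of_int a * ((xi_fps ^ n * c) oo (- fps_X)) + ((f * c) oo (- fps_X))"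
    by (simp add: fps_compose_add_distrib fps_compose_mult_distrib of_int_compose)
  ultimately have "(of_int a * xi_fps ^ n + f) * c + (((of_int a * xi_fps ^ n + f) * c) oo (- fps_X)) =
      of_int a * (xi_fps ^ n * c + ((xi_fps ^ n * c) oo (- fps_X))) + (f * c + ((f * c) oo (- fps_X)))"
    by (simp only: algebra_simps)
  also have "\<dots> = 2 * (of_int a * g1 + g2)"
    unfolding g1(2) g2(2) by (simp only: algebra_simps)
  finally show ?case
    using int_combs_add[OF int_combs_smult[OF g1(1)] g2(1)] by blast
qed

text \<open>The even series gamma(q^2)^(2W) can be pulled out of the even part, leaving
  P_(k+1)(q^2).\<close>

lemma PDO_section_step:
  assumes "gamma_fps ^ W * PDO_section k \<in> int_combs (xi_range W) xi_fps"
  shows "gamma_fps ^ (2 * W) * PDO_section (Suc k) \<in> int_combs (xi_range (2 * W)) xi_fps"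
proof -
  let ?g = "gamma_fps oo fps_X ^ 2"
  define G where "G = ?g ^ (2 * W) * PDO_section k"
  have "gamma_fps ^ W * PDO_section k * ((1 + dissect) ^ (5 * W) * xi_sq ^ (5 * W)) = G"
  proof -
    have 1: "xi_sq * (1 - dissect) * (1 + dissect) = 1"
      using xi_compose_dissect by (simp add: algebra_simps power2_eq_square)
    have "gamma_fps ^ W = ?g ^ (2 * W) * (1 - dissect) ^ (5 * W)"
      by (subst gamma_dissect [symmetric]) (simp only: power_mult_distrib power_mult)
    then have "gamma_fps ^ W * PDO_section k * ((1 + dissect) ^ (5 * W) * xi_sq ^ (5 * W)) =
        G * (xi_sq * (1 - dissect) * (1 + dissect)) ^ (5 * W)"
      by (simp only: G_def power_mult_distrib mult_ac)
    then show ?thesis by (simp only: 1 power_one mult_1_right)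
  qed
  with xi_poly_even_part[OF assms] obtain g where
    g: "g \<in> int_combs (xi_range (2 * W)) xi_sq" "G + (G oo (- fps_X)) = 2 * g"
    by auto
  have "G oo (- fps_X) = ?g ^ (2 * W) * (PDO_section k oo (- fps_X))"
    by (simp add: G_def fps_compose_mult_distrib fps_compose_power [symmetric] fps_even_compose_uminus)
  then have "G + (G oo (- fps_X)) = ?g ^ (2 * W) * (PDO_section k + (PDO_section k oo (- fps_X)))"
    by (simp only: G_def distrib_left)
  also have "\<dots> = 2 * ((gamma_fps ^ (2 * W) * PDO_section (Suc k)) oo fps_X ^ 2)"
    unfolding PDO_section_Suc [symmetric]
    by (simp add: fps_compose_mult_distrib fps_compose_power [symmetric] mult_ac)
  finally have eq: "(gamma_fps ^ (2 * W) * PDO_section (Suc k)) oo fps_X ^ 2 = g"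
    using g(2) by simp
  obtain p where p: "\<forall>i. coeff p i \<noteq> 0 \<longrightarrow> i \<in> xi_range (2 * W)" "g = poly (map_poly of_int p) xi_sq"
    using g(1) unfolding int_combs_def by blast
  \<comment> \<open>The polynomial found at xi(q^2) is reused at xi(q), since substituting X^2 is
    injective.\<close>
  have "poly (map_poly of_int p) xi_fps oo fps_X ^ 2 = g"
    unfolding p(2) by (rule poly_of_int_compose) simp
  with eq have "gamma_fps ^ (2 * W) * PDO_section (Suc k) = poly (map_poly of_int p) xi_fps"
    by (metis fps_compose_X_power_inject zero_less_numeral)
  then show ?thesis
    using p(1) unfolding int_combs_def by blast
qed

lemma gamma_PDO_section:
  "gamma_fps ^ 2 ^ k * PDO_section (k + 2) \<in> int_combs (xi_range (2 ^ k)) xi_fps"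
proof (induction k)
  case 0
  \<comment> \<open>The exponents 2 and 3 are exactly those in \<open>xi_range 1\<close>.\<close>
  have "of_int 3 * xi_fps ^ 2 + of_int (- 2) * xi_fps ^ 3 \<in> int_combs (xi_range 1) xi_fps"
    by (intro int_combs_add int_combs_monom) (auto simp: xi_range_def)
  also have "of_int 3 * xi_fps ^ 2 + of_int (- 2) * xi_fps ^ 3 = gamma_fps * PDO_section 2"
    unfolding gamma_PDO_section_2 by (simp add: algebra_simps power2_eq_square power3_eq_cube)
  finally show ?case by (simp only: power_0 power_one_right add_0)
next
  case (Suc k)
  from PDO_section_step[OF Suc] show ?case by simp
qed

lemma gamma_power_6_power: "(gamma_fps ^ 6) ^ j \<in> int_combs {10 * j..} xi_fps"
proof (induction j)
  case 0
  show ?case using int_combs_monom[of 0 "{10 * 0..}" 1 xi_fps] by simp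
next
  case (Suc j)
  have "of_int 9 * xi_fps ^ 0 - of_int 8 * xi_fps ^ 1 \<in> int_combs {..1} xi_fps"
    by (intro int_combs_diff int_combs_monom) auto
  then have "(9 - 8 * xi_fps) ^ 5 \<in> int_combs {..1 * 5} xi_fps"
    by (intro int_combs_power) simp
  moreover have "xi_fps ^ 10 \<in> int_combs {10} xi_fps"
    using int_combs_monom[of 10 "{10}" 1 xi_fps] by simp
  ultimately have "gamma_fps ^ 6 \<in> int_combs {10..} xi_fps"
    unfolding gamma_power_6 by (rule_tac int_combs_mult) auto
  then have "gamma_fps ^ 6 * (gamma_fps ^ 6) ^ j \<in> int_combs {10 * Suc j..} xi_fps"
    by (rule int_combs_mult[OF _ Suc]) auto
  then show ?case by simp
qed

text \<open>For the second section the recursion supplies only weight 2^(k-2). With k = j + 3 the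
  rest is covered by 2^k = 6 * 2^j + 2^(j+1): powers of gamma^6 contribute at least 10 * 2^j, and
  three times the sum of both bounds is exactly 5 * 2^k.\<close>

lemma Phi_int_combs:
  assumes "k \<ge> 3"
  shows "Phi k \<in> int_combs {i. 5 * 2 ^ k \<le> 3 * i} xi_fps"
proof -
  obtain j where j: "k = j + 3" using assms by (metis add.commute le_Suc_ex)
  have "gamma_fps ^ 2 ^ k * PDO_section (k + 2) \<in> int_combs {i. 5 * 2 ^ k \<le> 3 * i} xi_fps"
    by (rule int_combs_mono[OF gamma_PDO_section]) (auto simp: xi_range_def)
  moreover have "gamma_fps ^ 2 ^ k * PDO_section k \<in> int_combs {i. 5 * 2 ^ k \<le> 3 * i} xi_fps"
  proof -
    have k: "j + 1 + 2 = k" by (simp add: j)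
    have "gamma_fps ^ 2 ^ k = (gamma_fps ^ 6) ^ 2 ^ j * gamma_fps ^ 2 ^ (j + 1)"
    proof -
      have "(2::nat) ^ k = 6 * 2 ^ j + 2 ^ (j + 1)" by (simp add: j power_add)
      then show ?thesis by (simp only: power_add power_mult)
    qed
    moreover have "(gamma_fps ^ 6) ^ 2 ^ j * (gamma_fps ^ 2 ^ (j + 1) * PDO_section k)
        \<in> int_combs {i. 5 * 2 ^ k \<le> 3 * i} xi_fps"
      by (rule int_combs_mult[OF gamma_power_6_power gamma_PDO_section[of "j + 1", unfolded k]]) (auto simp: xi_range_def j power_add)
    ultimately show ?thesis by (simp only: mult.assoc)
  qed
  ultimately show ?thesis
    unfolding Phi_def PDO_section_def [symmetric] right_diff_distrib by (rule int_combs_diff)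
qed

text \<open>Because 4^i is 1 modulo 3, 5 * 2^k = 40 * 4^i is 1 modulo 3 for odd k, and 80 * 4^i is 2
  for even k. The summands 2 and 1 in 3 tau are exactly what rounds up to a multiple of 3.\<close>

lemma tau_bound:
  assumes "k \<ge> 3" and "of_nat m < tau k"
  shows "3 * m < 5 * 2 ^ k"
proof (cases "odd k")
  case True
  then obtain j where "k = 2 * j + 1" by (rule oddE)
  moreover define i where "i = j - 1"
  ultimately have k: "k = 2 * i + 3" and j: "j = i + 1" using assms(1) by auto
  have "tau k = 7 * 2 ^ (2 * i + 1) - 2 / 3 * (4 ^ i - 1)"
    by (simp add: tau_def k Let_def)
  also have "\<dots> = (40 * 4 ^ i + 2) / 3"
    unfolding power_add power_mult by (simp add: field_simps)
  finally have "of_nat (3 * m) < (of_nat (40 * 4 ^ i + 2) :: rat)"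
    using assms(2) by simp
  then have "3 * m < 40 * 4 ^ i + (2 :: nat)" by (simp only: of_nat_less_iff)
  moreover have "(4 ^ i :: nat) mod 3 = 1"
    by (induction i) (simp_all add: mod_mult_right_eq[symmetric])
  moreover have "3 * m < 40 * a" if a: "3 * m < 40 * a + 2" "a mod 3 = 1" for a
  proof -
    obtain b where "a = 3 * b + 1" using a(2) by (metis mult_div_mod_eq)
    with a(1) have "m < 40 * b + 14" by linarith
    with \<open>a = 3 * b + 1\<close> show ?thesis by linarith
  qed
  ultimately have "3 * m < 40 * 4 ^ i" by blast
  then show ?thesis by (simp add: k power_add power_mult)
next
  case False
  then obtain j where "k = 2 * j" by auto
  moreover define i where "i = j - 2"
  ultimately have k: "k = 2 * i + 4" and j: "j = i + 2" using assms(1) by auto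
  have "tau k = 7 * 2 ^ (2 * i + 2) - 1 / 3 * (4 ^ (i + 1) - 1)"
    by (simp add: tau_def k Let_def)
  also have "\<dots> = (80 * 4 ^ i + 1) / 3"
    unfolding power_add power_mult by (simp add: field_simps)
  finally have "of_nat (3 * m) < (of_nat (80 * 4 ^ i + 1) :: rat)"
    using assms(2) by simp
  then have "3 * m < 80 * 4 ^ i + (1 :: nat)" by (simp only: of_nat_less_iff)
  moreover have "(4 ^ i :: nat) mod 3 = 1"
    by (induction i) (simp_all add: mod_mult_right_eq[symmetric])
  moreover have "3 * m < 80 * a" if a: "3 * m < 80 * a + 1" "a mod 3 = 1" for a
  proof -
    obtain b where "a = 3 * b + 1" using a(2) by (metis mult_div_mod_eq)
    with a(1) have "m < 80 * b + 27" by linarith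
    with \<open>a = 3 * b + 1\<close> show ?thesis by linarith
  qed
  ultimately have "3 * m < 80 * 4 ^ i" by blast
  then show ?thesis by (simp add: k power_add power_mult)
qed

theorem theorem5p2:
  fixes k m :: nat
  assumes "k \<ge> 3" and "of_nat m < tau k"
  shows "F k m = 0"
proof -
  obtain p where p: "\<And>i. coeff p i \<noteq> 0 \<Longrightarrow> 5 * 2 ^ k \<le> 3 * i" "Phi k = poly (map_poly of_int p) xi_fps"
    using Phi_int_combs[OF assms(1)] unfolding int_combs_def by blast
  \<comment> \<open>Injectivity of evaluation at xi identifies the described polynomial with the one
    whose support is controlled.\<close>
  have "(THE p :: int poly. Phi k = poly (map_poly of_int p) xi_fps) = p"
    by (rule the_equality) (use p(2) poly_xi_inject in auto)
  then show ?thesis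
    using p(1)[of m] tau_bound[OF assms] unfolding F_def by force
qed

end
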